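(* The KickNext algorithm with parameter $p=0.08$ is $0.053$-competitive for the laminar matroid secretary problem: for every laminar matroid and every (nonnegative, distinct) weight assignment, its output $SOL$ satisfies $\mathbb E[w(SOL)]\ge 0.053\,w(\mathrm{OPT})$.
   Context: Let $U$ be a finite ground set, $n=|U|$, with weight function $w:U\to\mathbb{R}_{\ge0}$ taking pairwise distinct values; for $X\subseteq U$, $w(X)=\sum_{x\in X}w(x)$. Let $\mathcal F$ be a laminar family of subsets of $U$ (for any $A,B\in\mathcal F$: $A\subseteq B$, $B\subseteq A$, or $A\cap B=\emptyset$) with $U\in\mathcal F$; each $A\in\mathcal F$ has a positive integer capacity $\mu(A)$, with $\mu(A)<\mu(B)$ whenever $A\subsetneq B$. A set $X\subseteq U$ is independent iff $|X\cap A|\le\mu(A)$ for all $A\in\mathcal F$. For $i\in U$, $M(i)$ denotes the minimal member of $\mathcal F$ containing $i$. For $A\subseteq B$ in $\mathcal F$, $\mathrm{Chain}[A,B]$ is the sequence of all $B'\in\mathcal F$ with $A\subseteq B'\subseteq B$, ordered by inclusion from $A$ up to $B$. For $V\subseteq U$ and $B\in\mathcal F$, $\mathrm{OPT}_V(B)$ is the maximum-weight independent subset of $V\cap B$; $\mathrm{OPT}=\mathrm{OPT}_U(U)$. Random model (with parameter $p\in(0,1)$): a uniformly random ordering $\pi$ of $U$ is drawn and, independently, $t\sim\mathrm{Binom}(n,1-p)$; $S=\{\pi(1),\dots,\pi(t)\}$ and $T=U\setminus S$. KickNext algorithm: for each $B\in\mathcal F$ initialize $R(B)=\mathrm{OPT}_S(B)$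 and $SOL(B)=\emptyset$. Process the elements $i\in T$ in the order $\pi$; for each such $i$, visit the sets $B\in\mathrm{Chain}[M(i),U]$ in order from $M(i)$ upward; at each visited $B$: if $R(B)$ contains an element of weight less than $w(i)$, add $i$ to $SOL(B)$, remove from $R(B)$ the element of largest weight among those of weight less than $w(i)$, and continue to the next set in the chain; otherwise stop processing $i$. The output is $SOL=SOL(U)$. Standing convention of the paper: by padding $U$ with dummy elements of infinitesimal weight, one assumes $|\mathrm{OPT}_S(B)|=\mu(B)$ for every $B\in\mathcal F$. *)

theory Defs
  imports "HOL-Probability.Probability" "HOL-Combinatorics.Multiset_Permutations"
begin

definition laminar :: "'a set set \<Rightarrow> bool" where
  "laminar F \<longleftrightarrow> (\<forall>A\<in>F. \<forall>B\<in>F. A \<subseteq> B \<or> B \<subseteq> A \<or> A \<inter> B = {})"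

definition lam_indep :: "'a set set \<Rightarrow> ('a set \<Rightarrow> nat) \<Rightarrow> 'a set \<Rightarrow> bool" where
  "lam_indep F \<mu> X \<longleftrightarrow> (\<forall>A\<in>F. card (X \<inter> A) \<le> \<mu> A)"

definition OPT :: "'a set set \<Rightarrow> ('a set \<Rightarrow> nat) \<Rightarrow> ('a \<Rightarrow> real) \<Rightarrow> 'a set \<Rightarrow> 'a set \<Rightarrow> 'a set" where
  "OPT F \<mu> w V B = (SOME X. X \<subseteq> V \<inter> B \<and> lam_indep F \<mu> X \<and>
      (\<forall>Y. Y \<subseteq> V \<inter> B \<and> lam_indep F \<mu> Y \<longrightarrow> sum w Y \<le> sum w X))"

definition Mset :: "'a set set \<Rightarrow> 'a \<Rightarrow> 'a set" where
  "Mset F i = (THE A. A \<in> F \<and> i \<in> A \<and> (\<forall>B\<in>F. i \<in> B \<longrightarrow> A \<subseteq> B))"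

(* Chain[A,B] as a set; listed in inclusion order (= increasing cardinality for a chain) *)
definition Chain :: "'a set set \<Rightarrow> 'a set \<Rightarrow> 'a set \<Rightarrow> 'a set set" where
  "Chain F A B = {B' \<in> F. A \<subseteq> B' \<and> B' \<subseteq> B}"

definition chain_list :: "'a set set \<Rightarrow> 'a set \<Rightarrow> 'a set \<Rightarrow> 'a set list" where
  "chain_list F A B = sorted_key_list_of_set card (Chain F A B)"

(* State: R(B) = (real elements of R(B), number of padding dummies in R(B)); SOL(B).
   Dummies have weight below every real element (standing padding convention). *)
type_synonym 'a kn_state = "('a set \<Rightarrow> 'a set \<times> nat) \<times> ('a set \<Rightarrow> 'a set)"

fun kn_visit :: "('a \<Rightarrow> real) \<Rightarrow> 'a \<Rightarrow> 'a set list \<Rightarrow> 'a kn_state \<Rightarrow> 'a kn_state" where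
  "kn_visit w i [] st = st"
| "kn_visit w i (B # Bs) (R, SOL) =
     (let X = fst (R B); d = snd (R B); L = {x \<in> X. w x < w i} in
      if L \<noteq> {} then
        kn_visit w i Bs (R(B := (X - {arg_max_on w L}, d)), SOL(B := insert i (SOL B)))
      else if d > 0 then
        kn_visit w i Bs (R(B := (X, d - 1)), SOL(B := insert i (SOL B)))
      else (R, SOL))"

definition kn_process :: "'a set set \<Rightarrow> 'a set \<Rightarrow> ('a \<Rightarrow> real) \<Rightarrow> 'a \<Rightarrow> 'a kn_state \<Rightarrow> 'a kn_state" where
  "kn_process F U w i st = kn_visit w i (chain_list F (Mset F i) U) st"

definition kicknext :: "'a set set \<Rightarrow> ('a set \<Rightarrow> nat) \<Rightarrow> ('a \<Rightarrow> real) \<Rightarrow> 'a set \<Rightarrow> 'a list \<Rightarrow> nat \<Rightarrow> 'a set" where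
  "kicknext F \<mu> w U \<pi> t =
     (let S = set (take t \<pi>);
          R0 = (\<lambda>B. (OPT F \<mu> w S B, \<mu> B - card (OPT F \<mu> w S B)));
          st = fold (kn_process F U w) (drop t \<pi>) (R0, (\<lambda>B. {}))
      in snd st U)"

definition kicknext_expected :: "real \<Rightarrow> 'a set set \<Rightarrow> ('a set \<Rightarrow> nat) \<Rightarrow> ('a \<Rightarrow> real) \<Rightarrow> 'a set \<Rightarrow> real" where
  "kicknext_expected p F \<mu> w U =
     measure_pmf.expectation
       (pair_pmf (pmf_of_set (permutations_of_set U)) (binomial_pmf (card U) (1 - p)))
       (\<lambda>(\<pi>, t). sum w (kicknext F \<mu> w U \<pi> t))"

end

theory Submission
  imports Defs
begin

text \<open>
The arrival order plays no role. Fix \<open>v > 0\<close> and let \<open>Z\<close> be the elements of \<open>OPT\<close> of weight at least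
\<open>v\<close>; by Abel summation it suffices that \<open>E |Z \<inter> SOL| \<ge> 0.053 |Z|\<close>. As \<open>E |Z - S| = 0.08 |Z|\<close>, at most
\<open>0.027 |Z|\<close> elements of \<open>Z - S\<close> may be lost on average. (A single element of \<open>OPT\<close> can be lost with
probability close to 1, so the losses must be aggregated over \<open>Z\<close>.)

If \<open>f > 0\<close> elements of \<open>Z\<close> are blocked at \<open>B\<close>, let \<open>z\<close> be the lightest slot of \<open>B\<close> that survives. All
\<open>j\<close> slots below \<open>z\<close> were taken by elements below \<open>z\<close>, and the blocked elements lie below \<open>z\<close> too; so at
least \<open>j + f\<close> elements outside \<open>S\<close> below \<open>z\<close> improve the greedy solution of \<open>B\<close>, and moreover
\<open>\<mu> B - |Z \<inter> B| < j \<le> \<mu> B\<close>. Scanning \<open>B\<close> by decreasing weight, every element that improves the greedy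
solution is a biased coin flip, falling into \<open>S\<close> with probability \<open>0.92\<close>. Hence the loss at \<open>B\<close> is on
average at most the sum over these \<open>j\<close> of \<open>e j = E (G j - j)\<^sup>+\<close>, where \<open>G j\<close> counts the failures before
the \<open>j\<close>-th success. By laminarity and strict monotonicity of \<open>\<mu>\<close>, each \<open>j\<close> occurs for at most
\<open>(j + 1) |Z|\<close> sets \<open>B\<close>, and \<open>(\<Sum>j. (j + 1) e j) \<le> 0.027\<close>.
\<close>

section \<open>Random sampling as independent coin flips\<close>

text \<open>The expectation of \<open>g S\<close> when each element of \<open>X\<close> joins
  \<open>S\<close> independently with probability \<open>1 - p\<close>. As a finite sum it turns the
  probabilistic arguments into elementary inductions over \<open>X\<close>.\<close>

definition bern_sum :: "real \<Rightarrow> 'a set \<Rightarrow> ('a set \<Rightarrow> real) \<Rightarrow> real" where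
  "bern_sum p X g = (\<Sum>S\<in>Pow X. (1 - p) ^ card S * p ^ card (X - S) * g S)"

lemma bern_sum_empty [simp]: "bern_sum p {} g = g {}"
  by (simp add: bern_sum_def)

text \<open>Conditioning on the coin of \<open>x\<close>: the subsets of \<open>insert x X\<close>
  are those of \<open>X\<close> and their images under \<open>insert x\<close>.\<close>

lemma bern_sum_insert:
  assumes "finite X" "x \<notin> X"
  shows "bern_sum p (insert x X) g =
    bern_sum p X (\<lambda>S. (1 - p) * g (insert x S) + p * g S)"
proof -
  let ?h = "\<lambda>Y S. (1 - p) ^ card S * p ^ card (Y - S) * g S"
  have disj: "Pow X \<inter> insert x ` Pow X = {}"
    using assms(2) by auto
  have inj: "inj_on (insert x) (Pow X)"
    using assms(2) by (auto simp: inj_on_def)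
  have 1: "?h (insert x X) S = (1 - p) ^ card S * p ^ card (X - S) * (p * g S)" if "S \<in> Pow X" for S
  proof -
    have "insert x X - S = insert x (X - S)"
      using that assms(2) by auto
    then show ?thesis
      using assms by (simp add: card_insert_disjoint)
  qed
  have 2: "?h (insert x X) (insert x S) =
      (1 - p) ^ card S * p ^ card (X - S) * ((1 - p) * g (insert x S))" if "S \<in> Pow X" for S
  proof -
    have "insert x X - insert x S = X - S" "x \<notin> S" "finite S"
      using that assms finite_subset by auto
    then show ?thesis
      by simp
  qed
  have "bern_sum p (insert x X) g = sum (?h (insert x X)) (Pow X \<union> insert x ` Pow X)"
    unfolding bern_sum_def by (simp only: Pow_insert)
  also have "\<dots> = sum (?h (insert x X)) (Pow X) + sum (?h (insert x X) \<circ> insert x) (Pow X)"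
    using assms(1) disj by (simp add: sum.union_disjoint sum.reindex[OF inj])
  also have "\<dots> = bern_sum p X (\<lambda>S. (1 - p) * g (insert x S) + p * g S)"
    unfolding bern_sum_def sum.distrib[symmetric] o_def
    by (intro sum.cong refl) (subst 1, assumption, subst 2, assumption, simp add: distrib_left)
  finally show ?thesis .
qed

lemma bern_sum_mono:
  assumes "0 \<le> p" "p \<le> 1" "\<And>S. S \<subseteq> X \<Longrightarrow> f S \<le> g S"
  shows "bern_sum p X f \<le> bern_sum p X g"
  unfolding bern_sum_def using assms by (intro sum_mono mult_left_mono) auto

lemma bern_sum_const:
  assumes "finite X"
  shows "bern_sum p X (\<lambda>_. c) = c"
  using assms by (induction X) (simp_all add: bern_sum_insert algebra_simps)

lemma bern_sum_diff: "bern_sum p X (\<lambda>S. f S - g S) = bern_sum p X f - bern_sum p X g"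
  by (simp add: bern_sum_def right_diff_distrib sum_subtractf)

lemma bern_sum_sum: "bern_sum p X (\<lambda>S. \<Sum>b\<in>B. f b S) = (\<Sum>b\<in>B. bern_sum p X (f b))"
  unfolding bern_sum_def by (simp add: sum_distrib_left) (rule sum.swap)

lemma bern_sum_card_diff:
  assumes "finite X" "A \<subseteq> X"
  shows "bern_sum p X (\<lambda>S. real (card (A - S))) = p * real (card A)"
  using assms
proof (induction X arbitrary: A)
  case (insert x X)
  have fin: "finite (A - S)" for S
    using insert.prems insert.hyps finite_subset by blast
  show ?case
  proof (cases "x \<in> A")
    case True
    have A: "A - {x} \<subseteq> X" and cA: "card A = Suc (card (A - {x}))"
      using insert.prems insert.hyps finite_subset[OF insert.prems] card.remove[OF _ True] by auto
    \<comment> \<open>The constant \<open>p\<close> is added by subtracting \<open>- p\<close>, so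
      that \<open>bern_sum_diff\<close> can split it off.\<close>
    have "bern_sum p (insert x X) (\<lambda>S. real (card (A - S))) =
        bern_sum p X (\<lambda>S. real (card (A - {x} - S)) - (- p))"
      unfolding bern_sum_insert[OF insert.hyps(1,2)]
      unfolding bern_sum_def
    proof (rule sum.cong[OF refl])
      fix S assume "S \<in> Pow X"
      then have "A - S = insert x (A - {x} - S)" and "A - insert x S = A - {x} - S"
        using True insert.hyps by auto
      then have "card (A - S) = Suc (card (A - {x} - S))" and "card (A - insert x S) = card (A - {x} - S)"
        using fin[of "insert x S"] by (simp_all add: card_insert_disjoint)
      then show "(1 - p) ^ card S * p ^ card (X - S) *
          ((1 - p) * real (card (A - insert x S)) + p * real (card (A - S))) =
        (1 - p) ^ card S * p ^ card (X - S) * (real (card (A - {x} - S)) - (- p))"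
        by (simp add: algebra_simps)
    qed
    also have "\<dots> = p * real (card A)"
      using insert.IH[OF A] insert.hyps by (simp add: bern_sum_diff bern_sum_const cA algebra_simps del: diff_minus_eq_add)
    finally show ?thesis .
  next
    case False
    then have "A \<subseteq> X" "A - insert x S = A - S" for S
      using insert.prems by auto
    then show ?thesis
      using insert.IH[of A] by (simp add: bern_sum_insert[OF insert.hyps(1,2)] algebra_simps)
  qed
qed simp

section \<open>From a random ordering cut at a binomial point to independent coins\<close>

lemma card_permutations_take:
  assumes "finite U" "S \<subseteq> U"
  shows "card {\<pi> \<in> permutations_of_set U. set (take (card S) \<pi>) = S} =
    fact (card S) * fact (card U - card S)"
proof -
  have fS: "finite S"
    using assms finite_subset by auto
  have "bij_betw (\<lambda>(a, b). a @ b) (permutations_of_set S \<times> permutations_of_set (U - S))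
      {\<pi> \<in> permutations_of_set U. set (take (card S) \<pi>) = S}"
  proof (rule bij_betwI[where g = "\<lambda>\<pi>. (take (card S) \<pi>, drop (card S) \<pi>)"])
    show "(\<lambda>(a, b). a @ b) \<in> permutations_of_set S \<times> permutations_of_set (U - S) \<rightarrow>
        {\<pi> \<in> permutations_of_set U. set (take (card S) \<pi>) = S}"
      using assms by (auto simp: permutations_of_set_def distinct_card)
    show "(\<lambda>\<pi>. (take (card S) \<pi>, drop (card S) \<pi>)) \<in>
        {\<pi> \<in> permutations_of_set U. set (take (card S) \<pi>) = S} \<rightarrow>
        permutations_of_set S \<times> permutations_of_set (U - S)"
    proof
      fix \<pi> assume "\<pi> \<in> {\<pi> \<in> permutations_of_set U. set (take (card S) \<pi>) = S}"
      then have \<pi>: "set \<pi> = U" "distinct \<pi>" "set (take (card S) \<pi>) = S"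
        by (auto simp: permutations_of_set_def)
      have "set (take (card S) \<pi>) \<union> set (drop (card S) \<pi>) = U"
        using \<pi>(1) by (metis append_take_drop_id set_append)
      moreover have "set (take (card S) \<pi>) \<inter> set (drop (card S) \<pi>) = {}"
        using \<pi>(2) by (simp add: set_take_disj_set_drop_if_distinct)
      ultimately have "set (drop (card S) \<pi>) = U - S"
        using \<pi>(3) by auto
      then show "(take (card S) \<pi>, drop (card S) \<pi>) \<in> permutations_of_set S \<times> permutations_of_set (U - S)"
        using \<pi> by (auto simp: permutations_of_set_def)
    qed
  qed (auto simp: permutations_of_set_def distinct_card)
  then have "card (permutations_of_set S \<times> permutations_of_set (U - S)) =
      card {\<pi> \<in> permutations_of_set U. set (take (card S) \<pi>) = S}"
    by (rule bij_betw_same_card)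
  then show ?thesis
    using assms fS by (simp add: card_cartesian_product card_Diff_subset)
qed

lemma expectation_permutation_binomial:
  fixes f :: "'a list \<times> nat \<Rightarrow> real"
  assumes "finite U" "0 \<le> p" "p \<le> 1"
  shows "measure_pmf.expectation
      (pair_pmf (pmf_of_set (permutations_of_set U)) (binomial_pmf (card U) (1 - p))) f =
    (\<Sum>\<pi>\<in>permutations_of_set U. \<Sum>t\<le>card U.
      f (\<pi>, t) * (real (card U choose t) * (1 - p) ^ t * p ^ (card U - t) / fact (card U)))"
proof -
  have "measure_pmf.expectation
      (pair_pmf (pmf_of_set (permutations_of_set U)) (binomial_pmf (card U) (1 - p))) f =
    (\<Sum>a\<in>permutations_of_set U \<times> {..card U}. f a *
      pmf (pair_pmf (pmf_of_set (permutations_of_set U)) (binomial_pmf (card U) (1 - p))) a)"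
    using assms set_pmf_binomial_eq[of "1 - p" "card U"]
    by (intro integral_measure_pmf_real) (auto split: if_splits)
  also have "\<dots> = (\<Sum>(\<pi>, t)\<in>permutations_of_set U \<times> {..card U}.
      f (\<pi>, t) * (real (card U choose t) * (1 - p) ^ t * p ^ (card U - t) / fact (card U)))"
    using assms by (intro sum.cong) (auto simp: pmf_pair)
  finally show ?thesis
    by (simp add: sum.cartesian_product)
qed

text \<open>A set of size \<open>t\<close> is the prefix of \<open>t! (n - t)!\<close> of the
  \<open>n!\<close> orderings. This cancels the binomial coefficient, and what remains is the weight
  of the set under independent coins.\<close>

lemma expectation_sample_eq_bern_sum:
  assumes "finite U" "0 \<le> p" "p \<le> 1"
  shows "measure_pmf.expectation
      (pair_pmf (pmf_of_set (permutations_of_set U)) (binomial_pmf (card U) (1 - p)))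
      (\<lambda>(\<pi>, t). g (set (take t \<pi>))) = bern_sum p U g"
proof -
  let ?P = "permutations_of_set U" and ?n = "card U"
  let ?c = "\<lambda>t. (real (?n choose t) * (1 - p) ^ t * p ^ (?n - t) / fact ?n)"
  let ?T = "\<lambda>t. {S \<in> Pow U. card S = t}"
  have fibre: "(\<Sum>\<pi>\<in>?P. g (set (take t \<pi>)) * ?c t) =
      (\<Sum>S\<in>?T t. (1 - p) ^ card S * p ^ card (U - S) * g S)" if t: "t \<le> ?n" for t
  proof -
    have "(\<lambda>\<pi>. set (take t \<pi>)) ` ?P \<subseteq> ?T t"
      using t by (auto simp: permutations_of_set_def distinct_card min_def dest: in_set_takeD)
    then have "(\<Sum>\<pi>\<in>?P. g (set (take t \<pi>)) * ?c t) =
        (\<Sum>S\<in>?T t. \<Sum>\<pi>\<in>{\<pi> \<in> ?P. set (take t \<pi>) = S}. g (set (take t \<pi>)) * ?c t)"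
      using assms by (intro sum.group[symmetric]) auto
    also have "\<dots> = (\<Sum>S\<in>?T t. (1 - p) ^ card S * p ^ card (U - S) * g S)"
    proof (rule sum.cong[OF refl])
      fix S assume S: "S \<in> ?T t"
      then have "finite S"
        using assms finite_subset by auto
      have "(\<Sum>\<pi>\<in>{\<pi> \<in> ?P. set (take t \<pi>) = S}. g (set (take t \<pi>)) * ?c t) =
          real (card {\<pi> \<in> ?P. set (take t \<pi>) = S}) * (g S * ?c t)"
        by simp
      also have "card {\<pi> \<in> ?P. set (take t \<pi>) = S} = fact t * fact (?n - t)"
        using card_permutations_take[of U S] S assms by simp
      also have "real (fact t * fact (?n - t)) * (g S * ?c t) =
          (1 - p) ^ card S * p ^ card (U - S) * g S"
        using S t \<open>finite S\<close> by (simp add: binomial_fact card_Diff_subset)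
      finally show "(\<Sum>\<pi>\<in>{\<pi> \<in> ?P. set (take t \<pi>) = S}. g (set (take t \<pi>)) * ?c t) =
          (1 - p) ^ card S * p ^ card (U - S) * g S" .
    qed
    finally show ?thesis .
  qed
  have "measure_pmf.expectation (pair_pmf (pmf_of_set ?P) (binomial_pmf ?n (1 - p)))
      (\<lambda>(\<pi>, t). g (set (take t \<pi>))) = (\<Sum>t\<le>?n. \<Sum>\<pi>\<in>?P. g (set (take t \<pi>)) * ?c t)"
    by (subst expectation_permutation_binomial[OF assms], subst sum.swap) simp
  also have "\<dots> = (\<Sum>t\<in>{..?n}. \<Sum>S\<in>?T t. (1 - p) ^ card S * p ^ card (U - S) * g S)"
    by (rule sum.cong[OF refl]) (rule fibre, simp)
  also have "\<dots> = (\<Sum>S\<in>Pow U. (1 - p) ^ card S * p ^ card (U - S) * g S)"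
    using assms by (intro sum.group) (auto intro: card_mono)
  finally show ?thesis
    by (simp add: bern_sum_def)
qed

section \<open>Expected excess of failures\<close>

text \<open>Expected value of \<open>max 0 (G - d)\<close>, where \<open>G\<close> counts the failures (probability \<open>2/25\<close>) before the
  \<open>n\<close>-th success.\<close>

fun exp_excess :: "nat \<Rightarrow> nat \<Rightarrow> real" where
  "exp_excess n 0 = 2 / 23 * real n"
| "exp_excess 0 (Suc d) = 0"
| "exp_excess (Suc n) (Suc d) = 2 / 25 * exp_excess (Suc n) d + 23 / 25 * exp_excess n (Suc d)"

lemma exp_excess_nonneg: "0 \<le> exp_excess n d"
  by (induction n d rule: exp_excess.induct) auto

text \<open>With \<open>a = 23/15\<close> and \<open>b = 1/5\<close> the bound solves the recurrence
  with equality, as \<open>a b = 2/25 a + 23/25 b\<close>. The boundary \<open>d = 0\<close> follows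
  from Bernoulli's inequality. On the diagonal the ratio is \<open>a b = 23/75\<close>.\<close>

lemma exp_excess_le_geometric: "exp_excess n d \<le> 1 / 5 * (23 / 15) ^ n * (1 / 5) ^ d"
proof (induction n d rule: exp_excess.induct)
  case (1 n)
  have "1 + real n * (8 / 15) \<le> (1 + 8 / 15) ^ n"
    by (rule Bernoulli_inequality) simp
  then show ?case
    by simp
qed (auto simp: algebra_simps)

text \<open>The same expectation once \<open>g\<close> failures have occurred and \<open>n\<close> successes are still missing.\<close>

definition exp_excess_after :: "nat \<Rightarrow> nat \<Rightarrow> nat \<Rightarrow> real" where
  "exp_excess_after n d g = (if g \<le> d then exp_excess n (d - g) else real (g - d) + 2 / 23 * real n)"

lemma exp_excess_after_0 [simp]: "exp_excess_after n d 0 = exp_excess n d"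
  by (simp add: exp_excess_after_def)

lemma excess_le_exp_excess_after: "real (g - d) \<le> exp_excess_after n d g"
  by (simp add: exp_excess_after_def exp_excess_nonneg)

text \<open>Conditioning on the next coin. Below \<open>d\<close> this is the recursion of
  \<open>exp_excess\<close>; from \<open>d\<close> on every further failure counts, and each missing
  success is preceded by \<open>2/23\<close> failures on average.\<close>

lemma exp_excess_after_step: "23 / 25 * exp_excess_after n d g + 2 / 25 * exp_excess_after (Suc n) d (Suc g) = exp_excess_after (Suc n) d g"
proof -
  consider "g < d" | "g = d" | "d < g"
    by linarith
  then show ?thesis
  proof cases
    case 1
    then obtain e where "d - g = Suc e"
      by (metis Suc_diff_Suc)
    moreover from this have "d - Suc g = e"
      by simp
    ultimately show ?thesis
      using 1 by (simp add: exp_excess_after_def)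
  qed (auto simp: exp_excess_after_def field_simps of_nat_diff)
qed

lemma exp_excess_diag_1_to_5:
  "exp_excess 1 1 \<le> 0.006957" "exp_excess 2 2 \<le> 0.002138" "exp_excess 3 3 \<le> 0.000606" "exp_excess 4 4 \<le> 0.00017" "exp_excess 5 5 \<le> 0.000048"
  by (simp_all add: numeral_eq_Suc)

lemma sum_exp_excess_diag: "(\<Sum>j = 1..K. real (Suc j) * exp_excess j j) \<le> 0.027"
proof -
  \<comment> \<open>The added term majorizes the rest of the series: passing from \<open>K\<close>
    to \<open>Suc K\<close> lowers it by at least the new summand. The factor 0.14 is large enough
    for that and small enough for the base case \<open>K = 5\<close>.\<close>
  have tail: "(\<Sum>j = 1..K. real (Suc j) * exp_excess j j) + real (K + 3) * (23 / 75) ^ K * 0.14 \<le> 0.027"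
    if "5 \<le> K" for K
    using that
  proof (induction K rule: dec_induct)
    case base
    show ?case
    proof -
      have "{1..5} = {1, 2, 3, 4, 5 :: nat}"
        by auto
      then show ?thesis
        using exp_excess_diag_1_to_5 by (simp add: power_divide)
    qed
  next
    case (step K)
    have "exp_excess (Suc K) (Suc K) \<le> 1 / 5 * (23 / 15 * (1 / 5)) ^ Suc K"
      using exp_excess_le_geometric[of "Suc K" "Suc K"] by (simp only: power_mult_distrib mult.assoc)
    then have "real (Suc (Suc K)) * exp_excess (Suc K) (Suc K) \<le> real (Suc (Suc K)) * (1 / 5 * (23 / 75) ^ Suc K)"
      by (intro mult_left_mono) auto
    also have "\<dots> \<le> real (K + 3) * (23 / 75) ^ K * 0.14 - real (Suc K + 3) * (23 / 75) ^ Suc K * 0.14"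
      by (simp add: field_simps)
    finally show ?case
      using step.IH by simp
  qed
  show ?thesis
  proof (cases "5 \<le> K")
    case True
    have "0 \<le> real (K + 3) * (23 / 75) ^ K * 0.14"
      by simp
    then show ?thesis
      using tail[OF True] by linarith
  next
    case False
    then have "(\<Sum>j = 1..K. real (Suc j) * exp_excess j j) \<le> (\<Sum>j = 1..5. real (Suc j) * exp_excess j j)"
      by (intro sum_mono2) (auto simp: exp_excess_nonneg)
    moreover have "0 \<le> real (5 + 3) * (23 / 75) ^ 5 * (0.14 :: real)"
      by simp
    ultimately show ?thesis
      using tail[of 5] by linarith
  qed
qed

section \<open>A counting bound for laminar families, and Abel summation\<close>

lemma laminar_card_le:
  assumes "finite X" "H \<subseteq> Pow X" "laminar H" "\<And>A. A \<in> H \<Longrightarrow> 2 \<le> card A"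
  shows "card H \<le> card X"
  using assms
proof (induction "card X" arbitrary: X H)
  case 0
  have "A \<notin> H" for A
  proof
    assume "A \<in> H"
    then have "A = {}" "2 \<le> card A"
      using 0 by auto
    then show False
      by simp
  qed
  then have "H = {}"
    by blast
  then show ?case
    by simp
next
  case (Suc n)
  have finH: "finite H"
    using Suc.prems(1) by (intro finite_subset[OF Suc.prems(2)]) simp
  show ?case
  proof (cases "H = {}")
    case False
    \<comment> \<open>A minimal member \<open>A\<close> is dropped and one of its points
      \<open>x\<close> deleted. Another member that contains \<open>x\<close> properly contains
      \<open>A\<close>, so it still has at least two elements afterwards.\<close>
    obtain A where A: "A \<in> H" and minA: "\<And>B. B \<in> H \<Longrightarrow> B \<subseteq> A \<Longrightarrow> B = A"
      using finite_has_minimal[OF finH False] by auto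
    have "A \<noteq> {}"
      using Suc.prems(4)[OF A] by auto
    then obtain x where x: "x \<in> A"
      by auto
    let ?H' = "(\<lambda>B. B - {x}) ` (H - {A})"
    have finA: "finite B" if "B \<in> H" for B
      using that Suc.prems(1,2) finite_subset[of B X] by auto
    have sub: "A \<subset> B" if "B \<in> H - {A}" "B \<inter> A \<noteq> {}" for B
      using that A minA Suc.prems(3) unfolding laminar_def by blast
    have "\<not> A \<subseteq> {x}"
      using Suc.prems(4)[OF A] card_mono[of "{x}" A] by auto
    then obtain y where y: "y \<in> A" "y \<noteq> x"
      by auto
    \<comment> \<open>The second point \<open>y\<close> of \<open>A\<close> makes up for the deleted
      one: if \<open>B\<close> contains \<open>x\<close> it contains \<open>A\<close>, so
      \<open>C\<close> contains \<open>y\<close>, meets \<open>A\<close> and therefore contains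
      \<open>x\<close> too.\<close>
    have inj: "inj_on (\<lambda>B. B - {x}) (H - {A})"
    proof (rule inj_onI)
      fix B C assume BC: "B \<in> H - {A}" "C \<in> H - {A}" "B - {x} = C - {x}"
      have "x \<in> B \<longleftrightarrow> x \<in> C"
        using sub[OF BC(1)] sub[OF BC(2)] BC(3) x y by blast
      then show "B = C"
        using BC(3) by blast
    qed
    have "card ?H' \<le> card (X - {x})"
    proof (rule Suc.hyps)
      show "n = card (X - {x})"
        using Suc.hyps(2) Suc.prems(1,2) A x by (simp add: card_Diff_singleton subset_iff)
      show "finite (X - {x})" "?H' \<subseteq> Pow (X - {x})"
        using Suc.prems by auto
      show "laminar ?H'"
        using Suc.prems(3) unfolding laminar_def by blast
      show "2 \<le> card B'" if B': "B' \<in> ?H'" for B'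
      proof -
        obtain B where B: "B \<in> H - {A}" "B' = B - {x}"
          using B' by blast
        show ?thesis
        proof (cases "x \<in> B")
          case True
          then have "A \<subset> B"
            using sub[OF B(1)] x by auto
          then have "card A < card B"
            using finA[of B] B by (intro psubset_card_mono) auto
          then show ?thesis
            using Suc.prems(4)[OF A] True B finA[of B] by simp
        next
          case False
          then show ?thesis
            using B Suc.prems(4)[of B] by simp
        qed
      qed
    qed
    moreover have "card ?H' = card H - 1"
      using A finH by (simp add: card_image[OF inj])
    moreover have "card (X - {x}) = card X - 1" "card X > 0"
      using Suc.hyps(2) Suc.prems(1,2) A x by (auto simp: card_Diff_singleton subset_iff)
    ultimately show ?thesis
      by linarith
  qed simp
qed

text \<open>Lowering all weights by the least one, \<open>w a\<close>, splits off \<open>w a\<close>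
  times the sum over all of \<open>X\<close>, and the rest lives on \<open>X - {a}\<close>. Only
  positive thresholds are assumed because an optimum may treat elements of weight 0
  arbitrarily.\<close>

lemma abel_nonneg:
  fixes w g :: "'a \<Rightarrow> real"
  assumes "finite X" "\<And>x. x \<in> X \<Longrightarrow> 0 \<le> w x"
    and "\<And>v. 0 < v \<Longrightarrow> 0 \<le> (\<Sum>x\<in>{x \<in> X. v \<le> w x}. g x)"
  shows "0 \<le> (\<Sum>x\<in>X. w x * g x)"
  using assms
proof (induction "card X" arbitrary: X w rule: less_induct)
  case less
  show ?case
  proof (cases "X = {}")
    case False
    obtain a where a: "a \<in> X" "\<And>x. x \<in> X \<Longrightarrow> w a \<le> w x"
      using arg_min_if_finite[OF less.prems(1) False, of w] by (meson linorder_not_le)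
    have "0 \<le> (\<Sum>x\<in>X - {a}. (w x - w a) * g x)"
    proof (rule less.hyps)
      show "card (X - {a}) < card X"
        using a(1) less.prems(1) by (meson card_Diff1_less)
      show "finite (X - {a})" "\<And>x. x \<in> X - {a} \<Longrightarrow> 0 \<le> w x - w a"
        using less.prems(1) a by auto
      fix v :: real assume "0 < v"
      then have "{x \<in> X - {a}. v \<le> w x - w a} = {x \<in> X. v + w a \<le> w x}"
        by auto
      then show "0 \<le> (\<Sum>x\<in>{x \<in> X - {a}. v \<le> w x - w a}. g x)"
        using less.prems(3)[of "v + w a"] \<open>0 < v\<close> less.prems(2)[OF a(1)] by simp
    qed
    also have "\<dots> = (\<Sum>x\<in>X. (w x - w a) * g x)"
      using less.prems(1) a(1) by (simp add: sum.remove[of X a])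
    also have "\<dots> = (\<Sum>x\<in>X. w x * g x) - w a * (\<Sum>x\<in>X. g x)"
      by (simp add: left_diff_distrib sum_subtractf sum_distrib_left)
    finally have "w a * (\<Sum>x\<in>X. g x) \<le> (\<Sum>x\<in>X. w x * g x)"
      by simp
    moreover have "0 \<le> w a * (\<Sum>x\<in>X. g x)"
    proof (cases "w a = 0")
      case False
      then have "0 < w a"
        using less.prems(2)[OF a(1)] by simp
      moreover have "{x \<in> X. w a \<le> w x} = X"
        using a(2) by auto
      ultimately show ?thesis
        using less.prems(3)[of "w a"] by simp
    qed simp
    ultimately show ?thesis
      by linarith
  qed simp
qed

section \<open>Rank and optimum in a laminar matroid\<close>

locale laminar_matroid =
  fixes U :: "'a set" and F :: "'a set set" and \<mu> :: "'a set \<Rightarrow> nat" and w :: "'a \<Rightarrow> real"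
  assumes finite_U: "finite U"
    and w_nonneg: "x \<in> U \<Longrightarrow> 0 \<le> w x"
    and inj_w: "inj_on w U"
    and F_subset: "A \<in> F \<Longrightarrow> A \<subseteq> U"
    and U_in_F: "U \<in> F"
    and laminar_F: "laminar F"
    and mu_strict_mono: "\<lbrakk>A \<in> F; B \<in> F; A \<subset> B\<rbrakk> \<Longrightarrow> \<mu> A < \<mu> B"
begin

abbreviation ind :: "'a set \<Rightarrow> bool" where
  "ind \<equiv> lam_indep F \<mu>"

lemma finite_sub: "X \<subseteq> U \<Longrightarrow> finite X"
  using finite_U finite_subset by blast

lemma finite_F: "finite F"
  using finite_U F_subset by (meson Pow_iff finite_Pow_iff finite_subset subsetI)

lemma F_nested:
  assumes "A \<in> F" "B \<in> F" "x \<in> A" "x \<in> B"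
  shows "A \<subseteq> B \<or> B \<subseteq> A"
  using laminar_F assms unfolding laminar_def by blast

lemma w_eq_iff: "\<lbrakk>x \<in> U; y \<in> U\<rbrakk> \<Longrightarrow> w x = w y \<longleftrightarrow> x = y"
  using inj_w by (auto simp: inj_on_def)

lemma ind_empty: "ind {}"
  by (simp add: lam_indep_def)

lemma ind_card_le: "\<lbrakk>ind X; A \<in> F\<rbrakk> \<Longrightarrow> card (X \<inter> A) \<le> \<mu> A"
  by (simp add: lam_indep_def)

lemma ind_subset:
  assumes "ind X" "Y \<subseteq> X" "X \<subseteq> U"
  shows "ind Y"
  unfolding lam_indep_def
proof
  fix A assume "A \<in> F"
  have "card (Y \<inter> A) \<le> card (X \<inter> A)"
    using assms finite_sub by (intro card_mono) auto
  then show "card (Y \<inter> A) \<le> \<mu> A"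
    using ind_card_le[OF assms(1) \<open>A \<in> F\<close>] by linarith
qed

lemma ind_insertI:
  assumes "ind I" "I \<subseteq> U" "x \<notin> I" "\<And>A. A \<in> F \<Longrightarrow> x \<in> A \<Longrightarrow> card (I \<inter> A) < \<mu> A"
  shows "ind (insert x I)"
  unfolding lam_indep_def
proof
  fix A assume "A \<in> F"
  then show "card (insert x I \<inter> A) \<le> \<mu> A"
    using assms ind_card_le[OF assms(1)] finite_sub[OF assms(2)]
    by (cases "x \<in> A") (auto simp: Suc_le_eq)
qed

lemma ind_insertD:
  assumes "ind (insert x I)" "I \<subseteq> U" "x \<notin> I" "A \<in> F" "x \<in> A"
  shows "card (I \<inter> A) < \<mu> A"
  using ind_card_le[OF assms(1,4)] assms finite_sub[OF assms(2)] by simp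

text \<open>If nothing of \<open>J - I\<close> can be added, each of its elements lies in a tight
  set, one that \<open>I\<close> fills to capacity. Maximal tight sets are disjoint; in each of them
  \<open>J\<close> is no larger than \<open>I\<close>, and outside them \<open>J\<close> is
  contained in \<open>I\<close>.\<close>

lemma augment:
  assumes I: "ind I" "I \<subseteq> U" and J: "ind J" "J \<subseteq> U" and less: "card I < card J"
  shows "\<exists>x\<in>J - I. ind (insert x I)"
proof (rule ccontr)
  assume no: "\<not> ?thesis"
  define T where "T = {A \<in> F. \<mu> A \<le> card (I \<inter> A)}"
  define M where "M = {A \<in> T. \<forall>B\<in>T. A \<subseteq> B \<longrightarrow> A = B}"
  have finT: "finite T"
    using finite_F by (simp add: T_def)
  have cover: "x \<in> \<Union>M" if "x \<in> J - I" for x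
  proof -
    have "\<exists>A\<in>F. x \<in> A \<and> \<not> card (I \<inter> A) < \<mu> A"
      using no that ind_insertI[OF I, of x] by blast
    then obtain A where "A \<in> F" "x \<in> A" "\<not> card (I \<inter> A) < \<mu> A"
      by blast
    then have "A \<in> T" "x \<in> A"
      by (auto simp: T_def)
    moreover obtain B where "B \<in> T" "A \<subseteq> B" "\<forall>C\<in>T. B \<subseteq> C \<longrightarrow> B = C"
      using finite_has_maximal2[OF finT \<open>A \<in> T\<close>] by auto
    ultimately show ?thesis
      by (auto simp: M_def)
  qed
  have disj: "A \<inter> B = {}" if "A \<in> M" "B \<in> M" "A \<noteq> B" for A B
    using that F_nested[of A B] unfolding M_def T_def by blast
  have finM: "finite M"
    using finT by (simp add: M_def)
  have sum_card: "card (X \<inter> \<Union>M) = (\<Sum>A\<in>M. card (X \<inter> A))" if "X \<subseteq> U" for X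
    using finM disj that finite_sub unfolding Int_Union by (intro card_UN_disjoint) auto
  have "card (J \<inter> \<Union>M) \<le> card (I \<inter> \<Union>M)"
    unfolding sum_card[OF I(2)] sum_card[OF J(2)]
  proof (rule sum_mono)
    fix A assume "A \<in> M"
    then show "card (J \<inter> A) \<le> card (I \<inter> A)"
      using ind_card_le[OF J(1), of A] by (simp add: M_def T_def)
  qed
  moreover have "card (J - \<Union>M) \<le> card (I - \<Union>M)"
    using cover finite_sub[OF I(2)] by (intro card_mono) auto
  moreover have "card X = card (X \<inter> \<Union>M) + card (X - \<Union>M)" if "X \<subseteq> U" for X
    using finite_sub[OF that] by (rule card_Int_Diff)
  ultimately show False
    using less I(2) J(2) by (metis add_mono leD)
qed

lemma extend:
  assumes "ind I" "I \<subseteq> U" "ind J" "J \<subseteq> U" "card I \<le> card J"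
  obtains K where "I \<subseteq> K" "K \<subseteq> I \<union> J" "ind K" "card K = card J"
proof -
  have "\<exists>K. I \<subseteq> K \<and> K \<subseteq> I \<union> J \<and> ind K \<and> card K = card J"
    using assms(1,2,5)
  proof (induction "card J - card I" arbitrary: I)
    case 0
    then show ?case
      by (intro exI[of _ I]) auto
  next
    case (Suc n)
    have "card I < card J"
      using Suc.hyps(2) by linarith
    then obtain x where x: "x \<in> J - I" "ind (insert x I)"
      using augment[OF Suc.prems(1,2) assms(3,4)] by blast
    have "card (insert x I) = Suc (card I)"
      using x finite_sub[OF Suc.prems(2)] by simp
    moreover have "insert x I \<subseteq> U"
      using x Suc.prems assms(4) by auto
    moreover from calculation(1) have "n = card J - card (insert x I)" "card (insert x I) \<le> card J"
      using Suc.hyps(2) by linarith+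
    ultimately obtain K where "insert x I \<subseteq> K" "K \<subseteq> insert x I \<union> J" "ind K" "card K = card J"
      using Suc.hyps(1)[of "insert x I"] x(2) by blast
    then show ?case
      using x by (intro exI[of _ K]) auto
  qed
  then show ?thesis
    using that by blast
qed

section \<open>Matroid rank\<close>

definition rk :: "'a set \<Rightarrow> nat" where
  "rk Y = Max (card ` {X. X \<subseteq> Y \<and> ind X})"

lemma rk_finite: "Y \<subseteq> U \<Longrightarrow> finite (card ` {X. X \<subseteq> Y \<and> ind X})"
  by (simp add: finite_sub)

lemma card_le_rk: "\<lbrakk>Y \<subseteq> U; X \<subseteq> Y; ind X\<rbrakk> \<Longrightarrow> card X \<le> rk Y"
  unfolding rk_def by (intro Max_ge rk_finite) auto

lemma basis_exists:
  assumes "Y \<subseteq> U"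
  obtains X where "X \<subseteq> Y" "ind X" "card X = rk Y"
proof -
  have "rk Y \<in> card ` {X. X \<subseteq> Y \<and> ind X}"
    unfolding rk_def using ind_empty by (intro Max_in rk_finite[OF assms]) auto
  then show ?thesis
    using that by auto
qed

lemma rk_mono: "\<lbrakk>Z \<subseteq> Y; Y \<subseteq> U\<rbrakk> \<Longrightarrow> rk Z \<le> rk Y"
  by (metis basis_exists card_le_rk order_trans)

lemma rk_empty [simp]: "rk {} = 0"
  by (metis basis_exists card.empty empty_subsetI subset_empty)

lemma rk_le_mu:
  assumes "B \<in> F" "Y \<subseteq> B"
  shows "rk Y \<le> \<mu> B"
proof -
  have "Y \<subseteq> U"
    using assms F_subset by blast
  then obtain X where "X \<subseteq> Y" "ind X" "card X = rk Y"
    by (rule basis_exists)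
  then show ?thesis
    using ind_card_le[of X B] assms by (metis inf.absorb1 order_trans)
qed

lemma rk_insert_le:
  assumes "Y \<subseteq> U" "x \<in> U"
  shows "rk (insert x Y) \<le> Suc (rk Y)"
proof -
  obtain X where X: "X \<subseteq> insert x Y" "ind X" "card X = rk (insert x Y)"
    using basis_exists[of "insert x Y"] assms by auto
  have XU: "X \<subseteq> U"
    using X assms by auto
  then have "ind (X - {x})"
    using ind_subset[OF X(2)] by blast
  then have "card (X - {x}) \<le> rk Y"
    using X by (intro card_le_rk assms) auto
  then show ?thesis
    using X(3) finite_sub[OF XU] card_Diff1_le[of X x] by (cases "x \<in> X") (simp_all add: card_Diff_singleton)
qed

text \<open>A rank jump can be tested on any one basis: a larger independent set augments
  \<open>I\<close>, and the new element must be \<open>x\<close> because \<open>I\<close> is already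
  maximal in \<open>Y\<close>.\<close>

lemma basis_insert_iff:
  assumes "Y \<subseteq> U" "I \<subseteq> Y" "ind I" "card I = rk Y" "x \<in> U - Y"
  shows "rk Y < rk (insert x Y) \<longleftrightarrow> ind (insert x I)"
proof
  have IU: "I \<subseteq> U" and sU: "insert x Y \<subseteq> U"
    using assms by auto
  show "ind (insert x I)" if less: "rk Y < rk (insert x Y)"
  proof -
    obtain J where J: "J \<subseteq> insert x Y" "ind J" "card J = rk (insert x Y)"
      using basis_exists[OF sU] by blast
    obtain z where z: "z \<in> J - I" "ind (insert z I)"
      using augment[OF assms(3) IU J(2)] J sU less assms(4) by auto
    have "z \<notin> Y"
    proof
      assume "z \<in> Y"
      then have "card (insert z I) \<le> rk Y"
        using assms z by (intro card_le_rk) auto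
      then show False
        using z assms(4) finite_sub[OF IU] by simp
    qed
    then show ?thesis
      using z J(1) by auto
  qed
  show "rk Y < rk (insert x Y)" if "ind (insert x I)"
  proof -
    have "card (insert x I) \<le> rk (insert x Y)"
      using that assms sU by (intro card_le_rk) auto
    moreover have "x \<notin> I"
      using assms by auto
    ultimately show ?thesis
      using assms(4) finite_sub[OF IU] by simp
  qed
qed

text \<open>Submodularity in the form used below. A basis \<open>I\<close> of \<open>Z\<close>
  extends to a basis \<open>K\<close> of \<open>Y\<close>; if \<open>x\<close> can be added to
  \<open>K\<close>, it can be added to the subset \<open>I\<close>.\<close>

lemma rk_increment_antimono:
  assumes "Z \<subseteq> Y" "Y \<subseteq> U" "x \<in> U - Y" "rk Y < rk (insert x Y)"
  shows "rk Z < rk (insert x Z)"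
proof -
  have ZU: "Z \<subseteq> U"
    using assms by auto
  obtain I where I: "I \<subseteq> Z" "ind I" "card I = rk Z"
    using basis_exists[OF ZU] by blast
  obtain J where J: "J \<subseteq> Y" "ind J" "card J = rk Y"
    using basis_exists[OF assms(2)] by blast
  have IJ: "I \<subseteq> U" "J \<subseteq> U"
    using I J ZU assms by auto
  obtain K where K: "I \<subseteq> K" "K \<subseteq> I \<union> J" "ind K" "card K = card J"
    using extend[OF I(2) IJ(1) J(2) IJ(2)] I(3) J(3) rk_mono[OF assms(1,2)] by auto
  have "K \<subseteq> Y"
    using K(2) I(1) J(1) assms(1) by blast
  then have "ind (insert x K)"
    using basis_insert_iff[OF assms(2), of K x] K J(3) assms(3,4) by auto
  then have "ind (insert x I)"
    by (rule ind_subset) (use K IJ assms in auto)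
  then show ?thesis
    using basis_insert_iff[OF ZU I, of x] assms by auto
qed

section \<open>The optimum and its upper weight classes\<close>

abbreviation opt :: "'a set \<Rightarrow> 'a set \<Rightarrow> 'a set" where
  "opt \<equiv> OPT F \<mu> w"

lemma opt_props:
  assumes "V \<subseteq> U"
  shows "opt V B \<subseteq> V \<inter> B" "ind (opt V B)"
    and "\<And>Y. \<lbrakk>Y \<subseteq> V \<inter> B; ind Y\<rbrakk> \<Longrightarrow> sum w Y \<le> sum w (opt V B)"
proof -
  let ?Q = "{X. X \<subseteq> V \<inter> B \<and> ind X}"
  have fin: "finite ?Q"
    using finite_sub[OF assms] by simp
  have "{} \<in> ?Q"
    by (simp add: ind_empty)
  then have "Max (sum w ` ?Q) \<in> sum w ` ?Q"
    using fin by (intro Max_in) blast+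
  then obtain X where "Max (sum w ` ?Q) = sum w X" "X \<in> ?Q"
    by (rule imageE)
  moreover from this(1) have "\<forall>Y. Y \<subseteq> V \<inter> B \<and> ind Y \<longrightarrow> sum w Y \<le> sum w X"
    using fin Max_ge[of "sum w ` ?Q"] by (metis (mono_tags, lifting) finite_imageI imageI mem_Collect_eq)
  ultimately have "\<exists>X. X \<subseteq> V \<inter> B \<and> ind X \<and> (\<forall>Y. Y \<subseteq> V \<inter> B \<and> ind Y \<longrightarrow> sum w Y \<le> sum w X)"
    by blast
  from someI_ex[OF this]
  show "opt V B \<subseteq> V \<inter> B" "ind (opt V B)"
    "\<And>Y. \<lbrakk>Y \<subseteq> V \<inter> B; ind Y\<rbrakk> \<Longrightarrow> sum w Y \<le> sum w (opt V B)"
    unfolding OPT_def by blast+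
qed

text \<open>Positivity is essential: an optimum may or may not contain an element of weight 0.\<close>

lemma opt_upper_card:
  assumes V: "V \<subseteq> U"
    and H: "\<And>x. x \<in> V \<inter> B \<inter> H \<Longrightarrow> 0 < w x"
      "\<And>x y. \<lbrakk>x \<in> V \<inter> B \<inter> H; y \<in> V \<inter> B - H\<rbrakk> \<Longrightarrow> w y < w x"
  shows "card (opt V B \<inter> H) = rk (V \<inter> B \<inter> H)"
proof (rule ccontr)
  define O' where "O' = opt V B"
  define I where "I = O' \<inter> H"
  note opt = opt_props[OF V, where B = B, folded O'_def]
  have O'U: "O' \<subseteq> U" and IU: "I \<subseteq> U" and YU: "V \<inter> B \<inter> H \<subseteq> U"
    using opt(1) V by (auto simp: I_def)
  have finO: "finite O'"
    using finite_sub[OF O'U] .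
  have indI: "ind I"
    using ind_subset[OF opt(2) _ O'U] by (simp add: I_def)
  assume "card (opt V B \<inter> H) \<noteq> rk (V \<inter> B \<inter> H)"
  moreover have "card I \<le> rk (V \<inter> B \<inter> H)"
    using opt(1) by (intro card_le_rk YU indI) (auto simp: I_def)
  ultimately have less: "card I < rk (V \<inter> B \<inter> H)"
    by (simp add: I_def O'_def)
  obtain J where J: "J \<subseteq> V \<inter> B \<inter> H" "ind J" "card J = rk (V \<inter> B \<inter> H)"
    using basis_exists[OF YU] by blast
  obtain x where x: "x \<in> J - I" "ind (insert x I)"
    using augment[OF indI IU J(2)] J(1,3) YU less by (metis order_trans)
  have xH: "x \<in> V \<inter> B \<inter> H" and xO: "x \<notin> O'"
    using x J(1) by (auto simp: I_def)
  have ins: "insert x O' \<subseteq> V \<inter> B"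
    using xH opt(1) by auto
  have cI: "card (insert x I) = Suc (card I)"
    using x finite_sub[OF IU] by simp
  show False
  proof (cases "card O' \<le> card I")
    case True
    then have "I = O'"
      using finO by (intro card_seteq) (auto simp: I_def)
    then have "ind (insert x O')"
      using x by simp
    then have "sum w (insert x O') \<le> sum w O'"
      by (rule opt(3)[OF ins])
    then show False
      using xO finO H(1)[OF xH] by simp
  next
    case False
    moreover have "insert x I \<subseteq> U"
      using IU ins V by auto
    ultimately obtain K where K: "insert x I \<subseteq> K" "K \<subseteq> insert x I \<union> O'" "ind K" "card K = card O'"
      using extend[OF x(2) _ opt(2) O'U] cI by auto
    have Ksub: "K \<subseteq> insert x O'"
      using K(2) by (auto simp: I_def)
    have finK: "finite K"
      using Ksub finO finite_subset by blast
    \<comment> \<open>\<open>K\<close> is as large as \<open>O'\<close> and contains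
      \<open>x\<close> and \<open>I\<close>. Hence it is \<open>O'\<close> with one element
      \<open>y\<close> outside \<open>H\<close> exchanged for the heavier \<open>x\<close>, against
      optimality.\<close>
    have KO: "K - O' = {x}"
      using Ksub K(1) xO by auto
    have "card (O' - K) = card (K - O')"
      using K(4) finO finK card_Diff_subset_Int[of O' K] card_Diff_subset_Int[of K O'] by (simp add: Int_commute)
    then obtain y where y: "O' - K = {y}"
      by (auto simp: KO card_1_singleton_iff)
    have "y \<in> V \<inter> B - H"
      using y opt(1) K(1) by (auto simp: I_def)
    then have "w y < w x"
      using H(2)[OF xH] by blast
    moreover have "sum w K \<le> sum w O'"
      using K(3) Ksub ins by (intro opt(3)) auto
    moreover have "sum w K = sum w (K \<inter> O') + sum w (K - O')" "sum w O' = sum w (K \<inter> O') + sum w (O' - K)"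
      using sum.Int_Diff[OF finK, of w O'] sum.Int_Diff[OF finO, of w K] by (simp_all add: Int_commute)
    ultimately show False
      by (simp add: KO y)
  qed
qed

section \<open>Elements that improve the greedy solution of a sample\<close>

definition up :: "'a set \<Rightarrow> 'a \<Rightarrow> 'a set" where
  "up S x = {y \<in> S. w x < w y}"

lemma up_subset: "up S x \<subseteq> S"
  by (auto simp: up_def)

lemma up_insert_self:
  assumes "x \<in> U"
  shows "insert x (up U x) = {y \<in> U. w x \<le> w y}"
  using assms w_eq_iff[of x] by (auto simp: up_def less_le)

text \<open>The greedy procedure on \<open>insert x S \<inter> B\<close> would accept
  \<open>x\<close>. Only sampled elements heavier than \<open>x\<close> enter, so the condition is
  independent of the coin of \<open>x\<close>.\<close>

definition cand :: "'a set \<Rightarrow> 'a set \<Rightarrow> 'a \<Rightarrow> bool" where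
  "cand B S x \<longleftrightarrow> x \<in> B \<and> rk (up S x \<inter> B) < rk (insert x (up S x \<inter> B))"

lemma opt_above_card:
  assumes "S \<subseteq> U" "x \<in> U"
  shows "card {y \<in> opt S B. w x < w y} = rk (up S x \<inter> B)"
proof -
  have "card (opt S B \<inter> {y. w x < w y}) = rk (S \<inter> B \<inter> {y. w x < w y})"
    using w_nonneg[OF assms(2)] by (intro opt_upper_card assms) auto
  moreover have "opt S B \<inter> {y. w x < w y} = {y \<in> opt S B. w x < w y}"
    "S \<inter> B \<inter> {y. w x < w y} = up S x \<inter> B"
    by (auto simp: up_def)
  ultimately show ?thesis
    by simp
qed

lemma opt_atleast_card:
  assumes "S \<subseteq> U" "0 < w x"
  shows "card {y \<in> opt S B. w x \<le> w y} = rk ({y \<in> S. w x \<le> w y} \<inter> B)"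
proof -
  have "card (opt S B \<inter> {y. w x \<le> w y}) = rk (S \<inter> B \<inter> {y. w x \<le> w y})"
    using assms(2) by (intro opt_upper_card assms) auto
  moreover have "opt S B \<inter> {y. w x \<le> w y} = {y \<in> opt S B. w x \<le> w y}"
    "S \<inter> B \<inter> {y. w x \<le> w y} = {y \<in> S. w x \<le> w y} \<inter> B"
    by auto
  ultimately show ?thesis
    by simp
qed

text \<open>Meant for elements that KickNext let pass. The heavier part of \<open>opt S B\<close> is
  a basis of the heavier sample in \<open>B\<close>; sets inside \<open>B\<close> have room for
  \<open>x\<close> by assumption, and sets properly above \<open>B\<close> have strictly larger
  capacity.\<close>

lemma candI:
  assumes S: "S \<subseteq> U" and x: "x \<in> U" and B: "B \<in> F" "x \<in> B"
    and less: "\<And>A. \<lbrakk>A \<in> F; x \<in> A; A \<subseteq> B\<rbrakk> \<Longrightarrow> card {y \<in> opt S A. w x < w y} < \<mu> A"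
  shows "cand B S x"
proof -
  let ?I = "{y \<in> opt S B. w x < w y}"
  have sub: "up S x \<inter> B \<subseteq> U" "?I \<subseteq> up S x \<inter> B" "?I \<subseteq> U"
    using S opt_props(1)[OF S, of B] by (auto simp: up_def)
  have indI: "ind ?I"
    using ind_subset[OF opt_props(2)[OF S], of ?I B] opt_props(1)[OF S, of B] S by auto
  have "ind (insert x ?I)"
  proof (rule ind_insertI[OF indI sub(3)])
    fix A assume A: "A \<in> F" "x \<in> A"
    show "card (?I \<inter> A) < \<mu> A"
    proof (cases "A \<subseteq> B")
      case True
      have "card (?I \<inter> A) \<le> rk (up S x \<inter> A)"
        using sub S ind_subset[OF indI, of "?I \<inter> A"] by (intro card_le_rk) (auto simp: up_def)
      then show ?thesis
        using less[OF A True] opt_above_card[OF S x, of A] by linarith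
    next
      case False
      then have "B \<subset> A"
        using F_nested[OF A(1) B(1) A(2) B(2)] by auto
      then have "\<mu> B < \<mu> A"
        by (intro mu_strict_mono A B)
      moreover have "card (?I \<inter> A) \<le> card ?I"
        using finite_sub[OF sub(3)] by (intro card_mono) auto
      ultimately show ?thesis
        using less[OF B] by simp
    qed
  qed auto
  moreover have "x \<in> U - (up S x \<inter> B)"
    using x by (auto simp: up_def)
  ultimately show ?thesis
    using basis_insert_iff[OF sub(1,2) indI opt_above_card[OF S x]] B(2) by (auto simp: cand_def)
qed

text \<open>The optimum meets each upper weight class in as many elements as its rank, so the
  classes with and without \<open>x\<close> differ in rank by one.\<close>

lemma opt_rk_increment:
  assumes "x \<in> opt U U" "0 < w x"
  shows "rk (up U x) < rk (insert x (up U x))"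
proof -
  have OU: "opt U U \<subseteq> U"
    using opt_props(1)[of U U] by auto
  have xU: "x \<in> U"
    using OU assms by auto
  have eq: "{y \<in> opt U U. w x \<le> w y} = insert x {y \<in> opt U U. w x < w y}"
    using w_eq_iff OU xU assms(1) by fastforce
  have "card {y \<in> opt U U. w x \<le> w y} = Suc (card {y \<in> opt U U. w x < w y})"
    unfolding eq using finite_sub[OF OU] by simp
  moreover have "card {y \<in> opt U U. w x \<le> w y} = rk ({y \<in> U. w x \<le> w y})"
    using opt_atleast_card[of U x U] assms(2) by (simp add: Int_absorb2)
  moreover have "card {y \<in> opt U U. w x < w y} = rk (up U x)"
    using opt_above_card[of U x U] xU up_subset[of U x] by (simp add: Int_absorb2)
  ultimately show ?thesis
    by (simp add: up_insert_self[OF xU])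
qed

text \<open>An optimum element raises the rank of all heavier elements of \<open>U\<close>, hence by
  submodularity that of every subset of them, whatever the sample.\<close>

lemma cand_opt:
  assumes "x \<in> opt U U" "0 < w x" "S \<subseteq> U" "x \<in> B"
  shows "cand B S x"
proof -
  have "x \<in> U - up U x"
    using opt_props(1)[of U U] assms(1) by (auto simp: up_def)
  moreover have "up S x \<inter> B \<subseteq> up U x" "up U x \<subseteq> U"
    using assms(3) by (auto simp: up_def)
  ultimately have "rk (up S x \<inter> B) < rk (insert x (up S x \<inter> B))"
    using rk_increment_antimono opt_rk_increment[OF assms(1,2)] by blast
  then show ?thesis
    using assms(4) by (simp add: cand_def)
qed

text \<open>The heavier optimum elements in \<open>B\<close> already span everything in
  \<open>B\<close> above \<open>i\<close>, and \<open>i\<close> itself makes the inequality strict.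
  A tight set that blocks some \<open>x\<close> in \<open>B\<close> cannot contain \<open>i\<close>,
  which can still be added to \<open>?K\<close>; so it lies inside \<open>B\<close>, and the
  blocking takes place within \<open>B\<close>.\<close>

lemma rk_above_opt:
  assumes i: "i \<in> opt U U" "0 < w i" and B: "B \<in> F" "i \<in> B"
  shows "rk (up U i \<inter> B) < card {y \<in> opt U U \<inter> B. w i \<le> w y}"
proof -
  let ?K = "{y \<in> opt U U. w i < w y}"
  let ?I = "?K \<inter> B"
  have OU: "opt U U \<subseteq> U"
    using opt_props(1)[of U U] by auto
  have iU: "i \<in> U"
    using OU i by auto
  have KU: "?K \<subseteq> U" and IU: "?I \<subseteq> U" and YU: "up U i \<inter> B \<subseteq> U" "up U i \<subseteq> U"
    using OU by (auto simp: up_def)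
  have indK: "ind ?K"
    using ind_subset[OF opt_props(2)[of U U] _ OU] by auto
  have indI: "ind ?I"
    using ind_subset[OF indK _ KU] by auto
  have cK: "card ?K = rk (up U i)"
    using opt_above_card[of U i U] iU up_subset[of U i] by (simp add: Int_absorb2)
  have Ksub: "?K \<subseteq> up U i"
    using OU by (auto simp: up_def)
  have "ind (insert i ?K)"
    using basis_insert_iff[OF YU(2) Ksub indK cK, of i] opt_rk_increment[OF i] iU by (auto simp: up_def)
  then have i_free: "card (?K \<inter> A) < \<mu> A" if "A \<in> F" "i \<in> A" for A
    using ind_insertD[OF _ KU] that by auto
  have "rk (up U i \<inter> B) \<le> card ?I"
  proof (rule ccontr)
    assume "\<not> ?thesis"
    moreover obtain J where J: "J \<subseteq> up U i \<inter> B" "ind J" "card J = rk (up U i \<inter> B)"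
      using basis_exists[OF YU(1)] by blast
    ultimately obtain x where x: "x \<in> J - ?I" "ind (insert x ?I)"
      using augment[OF indI IU J(2)] YU(1) by auto
    have xi: "x \<in> U" "w i < w x" "x \<in> B" "x \<notin> ?K"
      using x J(1) by (auto simp: up_def)
    have "\<not> ind (insert x ?K)"
    proof
      assume "ind (insert x ?K)"
      then have "card (insert x ?K) \<le> rk (up U i)"
        using Ksub xi by (intro card_le_rk YU) (auto simp: up_def)
      then show False
        using cK xi(4) finite_sub[OF KU] by simp
    qed
    then obtain A where A: "A \<in> F" "x \<in> A" "\<mu> A \<le> card (?K \<inter> A)"
      using ind_insertI[OF indK KU xi(4)] by (meson not_le)
    have "i \<notin> A"
      using i_free[of A] A by auto
    then have "A \<subseteq> B"
      using F_nested[OF A(1) B(1) A(2) xi(3)] B(2) by auto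
    then have "?K \<inter> A = ?I \<inter> A"
      by auto
    then show False
      using ind_insertD[OF x(2) IU _ A(1,2)] x A(3) by auto
  qed
  also have "card ?I < card (insert i ?I)"
    using finite_sub[OF IU] by simp
  also have "\<dots> \<le> card {y \<in> opt U U \<inter> B. w i \<le> w y}"
    using i B finite_sub[OF OU] by (intro card_mono) auto
  finally show ?thesis .
qed

section \<open>Failures among the coin flips at one set\<close>

text \<open>In order of decreasing weight every candidate is a coin flip, and
  \<open>rk (up S x \<inter> B)\<close> counts the successes before \<open>x\<close>. These are
  therefore the failures from the \<open>a\<close>-th success on.\<close>

definition late_cands :: "'a set \<Rightarrow> 'a set \<Rightarrow> nat \<Rightarrow> 'a set \<Rightarrow> 'a set" where
  "late_cands X B a S = {x \<in> X - S. cand B S x \<and> a \<le> rk (up S x \<inter> B)}"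

text \<open>The expected excess over \<open>d\<close> of these failures if the flips went on until
  \<open>k\<close> successes, given \<open>s\<close> successes and \<open>g\<close> counted failures
  so far. Before the \<open>a\<close>-th success nothing has been counted.\<close>

definition potential :: "nat \<Rightarrow> nat \<Rightarrow> nat \<Rightarrow> nat \<Rightarrow> nat \<Rightarrow> real" where
  "potential k a d s g = (if s < a then exp_excess (k - a) d else exp_excess_after (k - s) d g)"

text \<open>Adding elements in decreasing order of weight, the potential is a supermartingale: only candidates
  change it, and a candidate falls into \<open>S\<close> independently of the earlier ones.\<close>

lemma bern_sum_potential:
  assumes B: "B \<in> F" and a: "a \<le> \<mu> B" and P: "finite P" "P \<subseteq> U"
  shows "bern_sum (2 / 25) P (\<lambda>S. potential (\<mu> B) a d (rk (S \<inter> B)) (card (late_cands P B a S)))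
    \<le> exp_excess (\<mu> B - a) d"
  using P
\<comment> \<open>Ranking by \<open>- w x\<close> adds the lightest element last, so its coin does
  not affect whether earlier elements are candidates.\<close>
proof (induction P rule: finite_ranking_induct[where f = "\<lambda>x. - w x"])
  case empty
  then show ?case
    by (simp add: potential_def late_cands_def)
next
  case (insert x P)
  show ?case
  proof (cases "x \<in> P")
    case True
    then show ?thesis
      using insert by (simp add: insert_absorb)
  next
    case False
    let ?\<phi> = "potential (\<mu> B) a d"
    have xU: "x \<in> U" and PU: "P \<subseteq> U"
      using insert.prems by auto
    have less: "w x < w y" if "y \<in> P" for y
    proof -
      have "w x \<noteq> w y"
        using w_eq_iff[of x y] that False xU PU by auto
      then show ?thesis
        using insert.hyps(2)[OF that] by simp
    qed
    have step: "(1 - 2 / 25) * ?\<phi> (rk (insert x S \<inter> B)) (card (late_cands (insert x P) B a (insert x S)))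
        + 2 / 25 * ?\<phi> (rk (S \<inter> B)) (card (late_cands (insert x P) B a S))
        \<le> ?\<phi> (rk (S \<inter> B)) (card (late_cands P B a S))" (is "?l \<le> ?r")
      if S: "S \<subseteq> P" for S
    proof -
      have SBU: "S \<inter> B \<subseteq> U"
        using S PU by auto
      have upx: "up S x = S"
        using S less by (auto simp: up_def)
      have xS: "x \<notin> S"
        using S False by auto
      have "up (insert x S) y = up S y" if "y \<in> P" for y
        using less[OF that] by (auto simp: up_def)
      then have l1: "late_cands (insert x P) B a (insert x S) = late_cands P B a S"
        using False by (auto simp: late_cands_def cand_def)
      have l2: "late_cands (insert x P) B a S =
          (if cand B S x \<and> a \<le> rk (S \<inter> B) then insert x (late_cands P B a S) else late_cands P B a S)"
        using xS by (auto simp: late_cands_def upx)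
      have "x \<notin> late_cands P B a S" "finite (late_cands P B a S)"
        using False insert.hyps(1) by (auto simp: late_cands_def)
      then have c2: "card (late_cands (insert x P) B a S) =
          (if cand B S x \<and> a \<le> rk (S \<inter> B) then Suc (card (late_cands P B a S)) else card (late_cands P B a S))"
        by (simp add: l2)
      show ?thesis
      proof (cases "cand B S x")
        case True
        then have xB: "x \<in> B" and gt: "rk (S \<inter> B) < rk (insert x (S \<inter> B))"
          by (auto simp: cand_def upx)
        have r1: "rk (insert x S \<inter> B) = Suc (rk (S \<inter> B))"
          using gt rk_insert_le[OF SBU xU] xB by simp
        then have lt: "Suc (rk (S \<inter> B)) \<le> \<mu> B"
          using rk_le_mu[OF B, of "insert x S \<inter> B"] by simp
        show ?thesis
        proof (cases "a \<le> rk (S \<inter> B)")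
          case a_le: True
          have "\<mu> B - rk (S \<inter> B) = Suc (\<mu> B - Suc (rk (S \<inter> B)))"
            using lt by simp
          then show ?thesis
            using exp_excess_after_step[of "\<mu> B - Suc (rk (S \<inter> B))" d "card (late_cands P B a S)"] True a_le
            by (simp add: l1 c2 r1 potential_def)
        next
          case a_gt: False
          have "late_cands P B a S = {}"
          proof -
            have "rk (up S y \<inter> B) \<le> rk (S \<inter> B)" for y
              using SBU by (intro rk_mono) (auto simp: up_def)
            then have "\<not> a \<le> rk (up S y \<inter> B)" for y
              using a_gt le_trans by blast
            then show ?thesis
              by (simp add: late_cands_def)
          qed
          \<comment> \<open>If this is the \<open>a\<close>-th success, the potential changes branch
            while no failure has been counted, and there both branches agree.\<close>
          moreover have "\<mu> B - Suc (rk (S \<inter> B)) = \<mu> B - a" if "\<not> Suc (rk (S \<inter> B)) < a"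
            using that a_gt by simp
          ultimately show ?thesis
            using True a_gt by (simp add: l1 c2 r1 potential_def)
        qed
      next
        case not_cand: False
        have "rk (insert x S \<inter> B) = rk (S \<inter> B)"
        proof (cases "x \<in> B")
          case True
          then show ?thesis
            using not_cand rk_mono[OF subset_insertI, of x "S \<inter> B"] SBU xU by (auto simp: cand_def upx)
        qed simp
        then show ?thesis
          using not_cand by (simp add: l1 c2)
      qed
    qed
    have "bern_sum (2 / 25) (insert x P) (\<lambda>S. ?\<phi> (rk (S \<inter> B)) (card (late_cands (insert x P) B a S)))
        \<le> bern_sum (2 / 25) P (\<lambda>S. ?\<phi> (rk (S \<inter> B)) (card (late_cands P B a S)))"
      unfolding bern_sum_insert[OF insert.hyps(1) False] by (intro bern_sum_mono step) auto
    also have "\<dots> \<le> exp_excess (\<mu> B - a) d"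
      using insert.IH PU by simp
    finally show ?thesis .
  qed
qed

text \<open>The actual flips may end before \<open>\<mu> B\<close> successes; the potential left at
  the end is still at least the excess reached.\<close>

lemma bern_sum_excess:
  assumes B: "B \<in> F" and a: "a \<le> \<mu> B"
  shows "bern_sum (2 / 25) U (\<lambda>S. real (card (late_cands U B a S) - d)) \<le> exp_excess (\<mu> B - a) d"
proof -
  have "real (card (late_cands U B a S) - d) \<le> potential (\<mu> B) a d (rk (S \<inter> B)) (card (late_cands U B a S))"
    if "S \<subseteq> U" for S
  proof (cases "rk (S \<inter> B) < a")
    case True
    have "rk (up S y \<inter> B) \<le> rk (S \<inter> B)" for y
      using that by (intro rk_mono) (auto simp: up_def)
    then have "\<not> a \<le> rk (up S y \<inter> B)" for y
      using True by (meson leD le_trans)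
    then have "late_cands U B a S = {}"
      by (simp add: late_cands_def)
    then show ?thesis
      using True by (simp add: potential_def exp_excess_nonneg)
  next
    case False
    then show ?thesis
      by (simp add: potential_def excess_le_exp_excess_after)
  qed
  then have "bern_sum (2 / 25) U (\<lambda>S. real (card (late_cands U B a S) - d)) \<le>
      bern_sum (2 / 25) U (\<lambda>S. potential (\<mu> B) a d (rk (S \<inter> B)) (card (late_cands U B a S)))"
    by (intro bern_sum_mono) auto
  also have "\<dots> \<le> exp_excess (\<mu> B - a) d"
    by (rule bern_sum_potential[OF assms finite_U]) simp
  finally show ?thesis .
qed

end

section \<open>Invariants of KickNext\<close>

definition open_slot :: "('a \<Rightarrow> real) \<Rightarrow> 'a \<Rightarrow> 'a set \<times> nat \<Rightarrow> bool" where
  "open_slot w i r \<longleftrightarrow> (\<exists>x\<in>fst r. w x < w i) \<or> 0 < snd r"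

definition kick :: "('a \<Rightarrow> real) \<Rightarrow> 'a \<Rightarrow> 'a set \<times> nat \<Rightarrow> 'a set \<times> nat" where
  "kick w i r = (let L = {x \<in> fst r. w x < w i} in
     if L \<noteq> {} then (fst r - {arg_max_on w L}, snd r) else (fst r, snd r - 1))"

text \<open>Each set occurs once in the list, so its slots are untouched when it is visited. All
  tests can thus be read from the initial \<open>R\<close>, and the sets passed form a
  prefix.\<close>

lemma kn_visit_eq:
  assumes "distinct Bs"
  shows "kn_visit w i Bs (R, SOL) =
    (\<lambda>B. if B \<in> set (takeWhile (\<lambda>B. open_slot w i (R B)) Bs) then kick w i (R B) else R B,
     \<lambda>B. if B \<in> set (takeWhile (\<lambda>B. open_slot w i (R B)) Bs) then insert i (SOL B) else SOL B)"
  using assms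
proof (induction Bs arbitrary: R SOL)
  case (Cons B Bs)
  show ?case
  proof (cases "open_slot w i (R B)")
    case True
    let ?R = "R(B := kick w i (R B))" and ?SOL = "SOL(B := insert i (SOL B))"
    have tw: "takeWhile (\<lambda>B. open_slot w i (?R B)) Bs = takeWhile (\<lambda>B. open_slot w i (R B)) Bs"
      using Cons.prems by (intro takeWhile_cong) auto
    have "kn_visit w i (B # Bs) (R, SOL) = kn_visit w i Bs (?R, ?SOL)"
      using True by (auto simp: open_slot_def kick_def Let_def)
    also have "\<dots> = (\<lambda>C. if C \<in> set (takeWhile (\<lambda>B. open_slot w i (R B)) Bs) then kick w i (?R C) else ?R C,
       \<lambda>C. if C \<in> set (takeWhile (\<lambda>B. open_slot w i (R B)) Bs) then insert i (?SOL C) else ?SOL C)"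
      using Cons.IH[of ?R ?SOL] Cons.prems unfolding tw distinct.simps by blast
    finally show ?thesis
      using True Cons.prems by (auto simp: fun_eq_iff dest: set_takeWhileD)
  next
    case False
    then show ?thesis
      by (auto simp: open_slot_def Let_def)
  qed
qed simp

lemma arg_max_on_finite:
  fixes w :: "'a \<Rightarrow> real"
  assumes "finite L" "L \<noteq> {}"
  shows "arg_max_on w L \<in> L" "\<And>y. y \<in> L \<Longrightarrow> w y \<le> w (arg_max_on w L)"
proof -
  obtain m where "m \<in> L" "\<And>y. y \<in> L \<Longrightarrow> w y \<le> w m"
    using arg_min_if_finite[OF assms, of "\<lambda>x. - w x"] by (meson neg_less_iff_less not_less)
  then have "is_arg_max w (\<lambda>x. x \<in> L) m"
    by (simp add: is_arg_max_linorder)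
  then have "is_arg_max w (\<lambda>x. x \<in> L) (arg_max_on w L)"
    unfolding arg_max_on_def arg_max_def by (rule someI)
  then show "arg_max_on w L \<in> L" "\<And>y. y \<in> L \<Longrightarrow> w y \<le> w (arg_max_on w L)"
    by (simp_all add: is_arg_max_linorder)
qed

lemma sorted_key_list_of_set_props:
  fixes f :: "'b \<Rightarrow> nat"
  assumes "inj_on f C" "finite C"
  shows "set (sorted_key_list_of_set f C) = C"
    and "distinct (sorted_key_list_of_set f C)"
    and "sorted (map f (sorted_key_list_of_set f C))"
proof -
  \<comment> \<open>Insertions commute because the keys are injective on \<open>C\<close>. From here
    on \<open>F\<close> denotes the resulting fold.\<close>
  interpret folding_on C "insort_key f" "[]"
  proof
    fix x y assume "x \<in> C" "y \<in> C"
    then show "insort_key f y \<circ> insort_key f x = insort_key f x \<circ> insort_key f y"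
      using assms(1) by (cases "x = y") (auto simp: fun_eq_iff inj_on_eq_iff intro: insort_key_left_comm)
  qed
  have "set (F B) = B \<and> distinct (F B) \<and> sorted (map f (F B))" if "B \<subseteq> C" for B
    using finite_subset[OF that assms(2)] that
  proof (induction B)
    case (insert x B)
    then show ?case
      by (simp add: insert set_insort_key distinct_insort sorted_insort_key)
  qed simp
  then show "set (sorted_key_list_of_set f C) = C"
    and "distinct (sorted_key_list_of_set f C)"
    and "sorted (map f (sorted_key_list_of_set f C))"
    unfolding sorted_key_list_of_set_def by blast+
qed

context laminar_matroid
begin

lemma kick_props:
  assumes "open_slot w i r" "fst r \<subseteq> U" "i \<in> U" "i \<notin> fst r"
  shows "fst (kick w i r) \<subseteq> fst r" "snd (kick w i r) \<le> snd r"
    and "Suc (card (fst (kick w i r)) + snd (kick w i r)) = card (fst r) + snd r"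
    and "z \<in> fst (kick w i r) \<Longrightarrow>
      card {y \<in> fst (kick w i r). w y < w z} + snd (kick w i r) + (if w i < w z then 1 else 0) =
      card {y \<in> fst r. w y < w z} + snd r"
proof -
  obtain X d where r: "r = (X, d)"
    by fastforce
  let ?L = "{x \<in> X. w x < w i}"
  have X: "X \<subseteq> U" "finite X" "i \<notin> X"
    using assms finite_sub r by auto
  have neq: "w z \<noteq> w i" if "z \<in> X" for z
    using w_eq_iff[of z i] that X assms(3) by auto
  show "fst (kick w i r) \<subseteq> fst r" "snd (kick w i r) \<le> snd r"
    by (auto simp: kick_def Let_def)
  have conj: "Suc (card (fst (kick w i r)) + snd (kick w i r)) = card (fst r) + snd r \<and>
    (z \<in> fst (kick w i r) \<longrightarrow>
      card {y \<in> fst (kick w i r). w y < w z} + snd (kick w i r) + (if w i < w z then 1 else 0) =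
      card {y \<in> fst r. w y < w z} + snd r)"
  proof (cases "?L = {}")
    case True
    then have "0 < d"
      using assms(1) by (auto simp: open_slot_def r)
    moreover have "w i < w z" if "z \<in> X"
      using True neq[OF that] that by fastforce
    ultimately show ?thesis
      using True by (auto simp: kick_def r)
  next
    case False
    define m where "m = arg_max_on w ?L"
    have "finite ?L"
      using X by simp
    from arg_max_on_finite[OF this False, where w = w]
    have m: "m \<in> X" "w m < w i" "\<And>y. y \<in> X \<Longrightarrow> w y < w i \<Longrightarrow> w y \<le> w m"
      by (auto simp: m_def)
    have kick: "kick w i (X, d) = (X - {m}, d)"
      using False by (auto simp: kick_def m_def)
    have "card {y \<in> X - {m}. w y < w z} + (if w i < w z then 1 else 0) = card {y \<in> X. w y < w z}"
      if z: "z \<in> X - {m}"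
    proof (cases "w i < w z")
      case True
      then have "{y \<in> X. w y < w z} = insert m {y \<in> X - {m}. w y < w z}"
        using m by auto
      then show ?thesis
        using True X(2) by simp
    next
      case False
      \<comment> \<open>The kicked slot \<open>m\<close> is the heaviest below \<open>i\<close>. A
        survivor \<open>z\<close> below \<open>i\<close> is thus no heavier than \<open>m\<close>,
        and the count under \<open>z\<close> does not change.\<close>
      then have "w z \<le> w m"
        using m(3) z neq[of z] by auto
      then have "{y \<in> X - {m}. w y < w z} = {y \<in> X. w y < w z}"
        by auto
      then show ?thesis
        using False by simp
    qed
    moreover have "Suc (card (X - {m})) = card X"
      using card.remove[OF X(2) m(1)] by simp
    ultimately show ?thesis
      by (auto simp: kick r)
  qed
  from conj show "Suc (card (fst (kick w i r)) + snd (kick w i r)) = card (fst r) + snd r"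
    by (rule conjunct1)
  from conj show "z \<in> fst (kick w i r) \<Longrightarrow>
      card {y \<in> fst (kick w i r). w y < w z} + snd (kick w i r) + (if w i < w z then 1 else 0) =
      card {y \<in> fst r. w y < w z} + snd r"
    by (rule mp[OF conjunct2])
qed

section \<open>The sets passed by one element\<close>

lemma Mset_props:
  assumes "i \<in> U"
  shows "Mset F i \<in> F" "i \<in> Mset F i" "\<And>B. \<lbrakk>B \<in> F; i \<in> B\<rbrakk> \<Longrightarrow> Mset F i \<subseteq> B"
proof -
  have "finite {A \<in> F. i \<in> A}" "{A \<in> F. i \<in> A} \<noteq> {}"
    using finite_F U_in_F assms by auto
  then obtain A where A: "A \<in> F" "i \<in> A" "\<And>B. \<lbrakk>B \<in> F; i \<in> B; B \<subseteq> A\<rbrakk> \<Longrightarrow> B = A"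
    using finite_has_minimal[of "{A \<in> F. i \<in> A}"] by blast
  have least: "A \<subseteq> B" if "B \<in> F" "i \<in> B" for B
    using F_nested[OF A(1) that(1) A(2) that(2)] A(3)[OF that] by blast
  have "Mset F i = A"
    unfolding Mset_def using A least by (intro the_equality) auto
  then show "Mset F i \<in> F" "i \<in> Mset F i" "\<And>B. \<lbrakk>B \<in> F; i \<in> B\<rbrakk> \<Longrightarrow> Mset F i \<subseteq> B"
    using A least by auto
qed

lemma chain_list_props:
  assumes "i \<in> U"
  shows "set (chain_list F (Mset F i) U) = {B \<in> F. i \<in> B}"
    and "distinct (chain_list F (Mset F i) U)"
    and "sorted (map card (chain_list F (Mset F i) U))"
proof -
  let ?C = "Chain F (Mset F i) U"
  have C: "?C = {B \<in> F. i \<in> B}"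
    using Mset_props[OF assms] F_subset by (auto simp: Chain_def)
  have "inj_on card ?C"
  proof (rule inj_onI)
    fix A B assume AB: "A \<in> ?C" "B \<in> ?C" "card A = card B"
    have "finite A" "finite B"
      using AB F_subset finite_sub unfolding C by auto
    moreover have "A \<subseteq> B \<or> B \<subseteq> A"
      using AB F_nested[of A B i] unfolding C by auto
    ultimately show "A = B"
      using AB(3) by (metis card_subset_eq)
  qed
  moreover have "finite ?C"
    using finite_F unfolding C by simp
  ultimately show "set (chain_list F (Mset F i) U) = {B \<in> F. i \<in> B}"
    and "distinct (chain_list F (Mset F i) U)"
    and "sorted (map card (chain_list F (Mset F i) U))"
    using sorted_key_list_of_set_props[of card ?C] by (simp_all add: chain_list_def C)
qed

definition passed :: "('a set \<Rightarrow> 'a set \<times> nat) \<Rightarrow> 'a \<Rightarrow> 'a set set" where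
  "passed R i = set (takeWhile (\<lambda>B. open_slot w i (R B)) (chain_list F (Mset F i) U))"

lemma kn_process_eq:
  assumes "i \<in> U"
  shows "kn_process F U w i (R, SOL) =
    (\<lambda>B. if B \<in> passed R i then kick w i (R B) else R B,
     \<lambda>B. if B \<in> passed R i then insert i (SOL B) else SOL B)"
  unfolding kn_process_def passed_def by (rule kn_visit_eq[OF chain_list_props(2)[OF assms]])

lemma passedD:
  assumes "i \<in> U" "B \<in> passed R i"
  shows "B \<in> F" "i \<in> B" "open_slot w i (R B)"
  using assms chain_list_props(1)[OF assms(1)] unfolding passed_def by (auto dest: set_takeWhileD)

text \<open>The passed sets are a prefix of a list sorted by cardinality, and proper subsets have
  smaller cardinality.\<close>

lemma passed_down:
  assumes "i \<in> U" "B \<in> passed R i" "A \<in> F" "i \<in> A" "A \<subseteq> B"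
  shows "A \<in> passed R i"
proof (cases "A = B")
  case False
  let ?Q = "\<lambda>B. open_slot w i (R B)" and ?xs = "chain_list F (Mset F i) U"
  have "card A < card B"
    using False assms passedD(1)[OF assms(1,2)] F_subset finite_sub by (intro psubset_card_mono) auto
  moreover have "sorted (map card (takeWhile ?Q ?xs @ dropWhile ?Q ?xs))"
    using chain_list_props(3)[OF assms(1)] by simp
  then have "card B \<le> card C" if "C \<in> set (dropWhile ?Q ?xs)" for C
    using assms(2) that unfolding passed_def map_append sorted_append by simp
  ultimately have "A \<notin> set (dropWhile ?Q ?xs)"
    by (meson not_less)
  moreover have "A \<in> set (takeWhile ?Q ?xs @ dropWhile ?Q ?xs)"
    using chain_list_props(1)[OF assms(1)] assms by simp
  ultimately show ?thesis
    unfolding passed_def set_append by blast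
qed (use assms in simp)

lemma not_passed_U:
  assumes "i \<in> U" "U \<notin> passed R i"
  obtains B where "B \<in> F" "i \<in> B" "B \<notin> passed R i" "\<not> open_slot w i (R B)"
proof -
  let ?Q = "\<lambda>B. open_slot w i (R B)" and ?xs = "chain_list F (Mset F i) U"
  have "set (takeWhile ?Q ?xs) \<noteq> set ?xs"
    using chain_list_props(1)[OF assms(1)] assms U_in_F by (auto simp: passed_def)
  then have "\<not> (\<forall>B\<in>set ?xs. ?Q B)"
    by (metis takeWhile_eq_all_conv)
  then obtain B where "B \<in> set ?xs" "\<not> ?Q B"
    by blast
  then show ?thesis
    using that chain_list_props(1)[OF assms(1)] passedD(3)[OF assms(1)] by blast
qed

text \<open>The equation for \<open>z\<close> says that the slots below a surviving slot \<open>z\<close> are taken exactly by the passing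
  elements below \<open>z\<close>, since heavier ones never kick below \<open>z\<close>.\<close>

definition local_inv :: "'a set \<Rightarrow> 'a set \<Rightarrow> 'a set \<Rightarrow> 'a set \<times> nat \<Rightarrow> 'a set \<Rightarrow> bool" where
  "local_inv S L B r P \<longleftrightarrow>
     P \<subseteq> L \<inter> B \<and> fst r \<subseteq> opt S B \<and> snd r \<le> \<mu> B - card (opt S B) \<and>
     card (fst r) + snd r + card P = \<mu> B \<and>
     (\<forall>z\<in>fst r. card {y \<in> fst r. w y < w z} + snd r + card {j \<in> P. w j < w z} =
       card {y \<in> opt S B. w y < w z} + (\<mu> B - card (opt S B))) \<and>
     (\<forall>j\<in>P. card {y \<in> opt S B. w j < w y} < \<mu> B)"

text \<open>\<open>L\<close> holds the elements processed so far. Slots only disappear, so a set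
  that blocked an element keeps blocking it, and the reason for a loss can be read off the final
  state.\<close>

definition run_inv :: "'a set \<Rightarrow> 'a set \<Rightarrow> 'a kn_state \<Rightarrow> bool" where
  "run_inv S L st \<longleftrightarrow>
     (\<forall>B\<in>F. local_inv S L B (fst st B) (snd st B)) \<and>
     (\<forall>B\<in>F. \<forall>j\<in>snd st B. \<forall>A\<in>F. j \<in> A \<longrightarrow> A \<subseteq> B \<longrightarrow> j \<in> snd st A) \<and>
     (\<forall>j\<in>L. j \<notin> snd st U \<longrightarrow> (\<exists>B\<in>F. j \<in> B \<and> j \<notin> snd st B \<and> \<not> open_slot w j (fst st B)))"

lemma run_invD:
  assumes "run_inv S L st"
  shows "B \<in> F \<Longrightarrow> local_inv S L B (fst st B) (snd st B)"
    and "\<lbrakk>B \<in> F; j \<in> snd st B; A \<in> F; j \<in> A; A \<subseteq> B\<rbrakk> \<Longrightarrow> j \<in> snd st A"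
    and "\<lbrakk>j \<in> L; j \<notin> snd st U\<rbrakk> \<Longrightarrow> \<exists>B\<in>F. j \<in> B \<and> j \<notin> snd st B \<and> \<not> open_slot w j (fst st B)"
proof -
  note inv = assms[unfolded run_inv_def]
  show "local_inv S L B (fst st B) (snd st B)" if "B \<in> F"
    using conjunct1[OF inv] that by (rule bspec)
  show "j \<in> snd st A" if "B \<in> F" "j \<in> snd st B" "A \<in> F" "j \<in> A" "A \<subseteq> B"
    by (rule conjunct1[OF conjunct2[OF inv], rule_format, OF that])
  show "\<exists>B\<in>F. j \<in> B \<and> j \<notin> snd st B \<and> \<not> open_slot w j (fst st B)" if "j \<in> L" "j \<notin> snd st U"
    by (rule conjunct2[OF conjunct2[OF inv], rule_format, OF that])
qed

lemma local_invD:
  assumes "local_inv S L B r P"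
  shows "P \<subseteq> L \<inter> B" "fst r \<subseteq> opt S B" "snd r \<le> \<mu> B - card (opt S B)"
    and "card (fst r) + snd r + card P = \<mu> B"
    and "z \<in> fst r \<Longrightarrow> card {y \<in> fst r. w y < w z} + snd r + card {j \<in> P. w j < w z} =
        card {y \<in> opt S B. w y < w z} + (\<mu> B - card (opt S B))"
    and "j \<in> P \<Longrightarrow> card {y \<in> opt S B. w j < w y} < \<mu> B"
  using assms by (simp_all add: local_inv_def)

lemma card_opt_le:
  assumes "S \<subseteq> U" "B \<in> F"
  shows "card (opt S B) \<le> \<mu> B"
  using ind_card_le[OF opt_props(2)[OF assms(1)] assms(2), of B] opt_props(1)[OF assms(1), of B]
  by (simp add: Int_absorb2)

lemma run_inv_init:
  assumes "S \<subseteq> U"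
  shows "run_inv S {} (\<lambda>B. (opt S B, \<mu> B - card (opt S B)), \<lambda>B. {})"
  using card_opt_le[OF assms] by (simp add: run_inv_def local_inv_def)

lemma local_inv_kick:
  assumes S: "S \<subseteq> U" and L: "L \<subseteq> U" and i: "i \<in> U - S" "i \<notin> L" and B: "B \<in> F" "i \<in> B"
    and inv: "local_inv S L B r P" and opn: "open_slot w i r"
  shows "local_inv S (insert i L) B (kick w i r) (insert i P)"
proof -
  note inv = local_invD[OF inv]
  have OS: "opt S B \<subseteq> S"
    using opt_props(1)[OF S] by auto
  have r: "fst r \<subseteq> U" "i \<notin> fst r"
    using inv(2) OS S i by auto
  note kick = kick_props[OF opn r(1) _ r(2)]
  have iU: "i \<in> U"
    using i by auto
  have iP: "i \<notin> P" and finP: "finite P" and finO: "finite (opt S B)"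
    using i inv(1) L S OS finite_sub by auto
  have "card {j \<in> insert i P. w j < w z} = card {j \<in> P. w j < w z} + (if w i < w z then 1 else 0)" for z
  proof (cases "w i < w z")
    case True
    then have "{j \<in> insert i P. w j < w z} = insert i {j \<in> P. w j < w z}"
      by auto
    then show ?thesis
      using True iP finP by simp
  next
    case False
    then have "{j \<in> insert i P. w j < w z} = {j \<in> P. w j < w z}"
      by auto
    then show ?thesis
      using False by simp
  qed
  then have "card {y \<in> fst (kick w i r). w y < w z} + snd (kick w i r) + card {j \<in> insert i P. w j < w z} =
      card {y \<in> opt S B. w y < w z} + (\<mu> B - card (opt S B))" if "z \<in> fst (kick w i r)" for z
    using kick(4)[OF iU that] inv(5)[of z] kick(1)[OF iU] that by auto
  \<comment> \<open>An open slot, be it a dummy or a real element lighter than \<open>i\<close>,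
    shows that the heavier elements of \<open>opt S B\<close> do not exhaust the capacity.\<close>
  moreover have "card {y \<in> opt S B. w i < w y} < \<mu> B"
  proof (cases "0 < snd r")
    case True
    have "card {y \<in> opt S B. w i < w y} \<le> card (opt S B)"
      using finO by (intro card_mono) auto
    then show ?thesis
      using True inv(3) by linarith
  next
    case False
    then obtain x where "x \<in> opt S B" "w x < w i"
      using opn inv(2) by (auto simp: open_slot_def)
    moreover from this have "x \<notin> {y \<in> opt S B. w i < w y}"
      by simp
    ultimately have "{y \<in> opt S B. w i < w y} \<subset> opt S B"
      by blast
    then have "card {y \<in> opt S B. w i < w y} < card (opt S B)"
      using finO by (intro psubset_card_mono)
    then show ?thesis
      using card_opt_le[OF S B(1)] by linarith
  qed
  moreover have "card (fst (kick w i r)) + snd (kick w i r) + card (insert i P) = \<mu> B"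
    using kick(3)[OF iU] inv(4) iP finP by simp
  moreover have "insert i P \<subseteq> insert i L \<inter> B"
    using inv(1) B(2) by auto
  moreover have "fst (kick w i r) \<subseteq> opt S B" "snd (kick w i r) \<le> \<mu> B - card (opt S B)"
    using kick(1,2)[OF iU] inv(2,3) by auto
  ultimately show ?thesis
    using inv(6) unfolding local_inv_def by blast
qed

lemma run_inv_step:
  assumes S: "S \<subseteq> U" and L: "L \<subseteq> U" and i: "i \<in> U - S" "i \<notin> L" and inv: "run_inv S L st"
  shows "run_inv S (insert i L) (kn_process F U w i st)"
proof -
  obtain R SOL where st: "st = (R, SOL)"
    by fastforce
  have iU: "i \<in> U"
    using i by auto
  define R' where "R' = (\<lambda>B. if B \<in> passed R i then kick w i (R B) else R B)"
  define SOL' where "SOL' = (\<lambda>B. if B \<in> passed R i then insert i (SOL B) else SOL B)"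
  have eq: "kn_process F U w i st = (R', SOL')"
    unfolding st R'_def SOL'_def by (rule kn_process_eq[OF iU])
  have loc: "local_inv S L B (R B) (SOL B)" if "B \<in> F" for B
    using run_invD(1)[OF inv that] by (simp add: st)
  have down: "j \<in> SOL A" if "B \<in> F" "j \<in> SOL B" "A \<in> F" "j \<in> A" "A \<subseteq> B" for A B j
    using run_invD(2)[OF inv that(1) _ that(3-5)] that(2) by (simp add: st)
  have SOL_L: "SOL B \<subseteq> L" if "B \<in> F" for B
    using local_invD(1)[OF loc[OF that]] by simp
  have "local_inv S (insert i L) B (R' B) (SOL' B)" if "B \<in> F" for B
  proof (cases "B \<in> passed R i")
    case True
    then show ?thesis
      using local_inv_kick[OF S L i that _ loc[OF that]] passedD[OF iU True]
      by (simp add: R'_def SOL'_def)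
  next
    case False
    then show ?thesis
      using loc[OF that] unfolding local_inv_def R'_def SOL'_def by auto
  qed
  moreover have "j \<in> SOL' A" if "B \<in> F" "j \<in> SOL' B" "A \<in> F" "j \<in> A" "A \<subseteq> B" for A B j
  proof (cases "j = i")
    case True
    then have "B \<in> passed R i"
      using that(2) SOL_L[OF that(1)] i(2) by (auto simp: SOL'_def split: if_splits)
    then have "A \<in> passed R i"
      using passed_down[OF iU] that True by auto
    then show ?thesis
      using True by (simp add: SOL'_def)
  next
    case False
    then have "j \<in> SOL B"
      using that(2) by (auto simp: SOL'_def split: if_splits)
    then show ?thesis
      using down[OF that(1) _ that(3-5)] by (simp add: SOL'_def)
  qed
  moreover have "\<exists>B\<in>F. j \<in> B \<and> j \<notin> SOL' B \<and> \<not> open_slot w j (R' B)"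
    if j: "j \<in> insert i L" "j \<notin> SOL' U" for j
  proof (cases "j = i")
    case True
    then have "U \<notin> passed R i"
      using j(2) by (auto simp: SOL'_def)
    then obtain B where "B \<in> F" "i \<in> B" "B \<notin> passed R i" "\<not> open_slot w i (R B)"
      using not_passed_U[OF iU] by blast
    then show ?thesis
      using True SOL_L[of B] i(2) by (auto simp: SOL'_def R'_def)
  next
    case False
    then have "j \<in> L" "j \<notin> SOL U"
      using j by (auto simp: SOL'_def split: if_splits)
    then obtain B where B: "B \<in> F" "j \<in> B" "j \<notin> SOL B" "\<not> open_slot w j (R B)"
      using run_invD(3)[OF inv] unfolding st by auto
    have "fst (kick w i (R B)) \<subseteq> fst (R B)" "snd (kick w i (R B)) \<le> snd (R B)"
      by (auto simp: kick_def Let_def)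
    then have "\<not> open_slot w j (R' B)"
      using B(4) by (auto simp: open_slot_def R'_def)
    then show ?thesis
      using B False by (auto simp: SOL'_def)
  qed
  ultimately show ?thesis
    by (simp add: run_inv_def eq)
qed

lemma run_inv_fold:
  assumes "S \<subseteq> U" "distinct (ys @ xs)" "set (ys @ xs) \<subseteq> U - S" "run_inv S (set ys) st"
  shows "run_inv S (set (ys @ xs)) (fold (kn_process F U w) xs st)"
  using assms
proof (induction xs arbitrary: ys st)
  case (Cons x xs)
  have "run_inv S (insert x (set ys)) (kn_process F U w x st)"
    using Cons.prems by (intro run_inv_step) auto
  then show ?case
    using Cons.IH[of "ys @ [x]" "kn_process F U w x st"] Cons.prems by simp
qed simp

lemma run_inv_kicknext:
  assumes "\<pi> \<in> permutations_of_set U"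
  obtains st where "kicknext F \<mu> w U \<pi> t = snd st U"
    "run_inv (set (take t \<pi>)) (U - set (take t \<pi>)) st"
proof -
  let ?S = "set (take t \<pi>)"
  have \<pi>: "set \<pi> = U" "distinct \<pi>"
    using assms by (auto simp: permutations_of_set_def)
  have "set (take t \<pi>) \<union> set (drop t \<pi>) = U"
    using \<pi>(1) by (metis append_take_drop_id set_append)
  moreover have "set (take t \<pi>) \<inter> set (drop t \<pi>) = {}"
    using \<pi>(2) by (simp add: set_take_disj_set_drop_if_distinct)
  ultimately have S: "?S \<subseteq> U" "set (drop t \<pi>) = U - ?S"
    by auto
  define st where "st = fold (kn_process F U w) (drop t \<pi>) (\<lambda>B. (opt ?S B, \<mu> B - card (opt ?S B)), \<lambda>B. {})"
  have "run_inv ?S (set ([] @ drop t \<pi>)) st"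
    unfolding st_def using \<pi> S run_inv_init[OF S(1)] by (intro run_inv_fold) auto
  then show ?thesis
    using that[of st] S by (simp add: kicknext_def st_def Let_def)
qed

text \<open>By downward closure \<open>j\<close> passed every set of its chain up to
  \<open>B\<close>, and the last clause of \<open>local_inv\<close> records the room it found there,
  as \<open>candI\<close> requires.\<close>

lemma late_cands_passed:
  assumes S: "S \<subseteq> U" and inv: "run_inv S (U - S) st" and B: "B \<in> F" "j \<in> snd st B"
    and a: "a \<le> rk (up S j \<inter> B)"
  shows "j \<in> late_cands U B a S"
proof -
  have j: "j \<in> U - S" "j \<in> B"
    using local_invD(1)[OF run_invD(1)[OF inv B(1)]] B(2) by auto
  have "cand B S j"
  proof (rule candI[OF S _ B(1) j(2)])
    fix A assume A: "A \<in> F" "j \<in> A" "A \<subseteq> B"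
    then have "j \<in> snd st A"
      using run_invD(2)[OF inv B] by blast
    then show "card {y \<in> opt S A. w j < w y} < \<mu> A"
      using local_invD(6)[OF run_invD(1)[OF inv A(1)]] by blast
  qed (use j in auto)
  then show ?thesis
    using j a by (simp add: late_cands_def)
qed

text \<open>The index is \<open>j = \<mu> B - a\<close>, with \<open>a\<close> the rank of the
  sampled elements in \<open>B\<close> no lighter than the lightest surviving slot \<open>z\<close>,
  or \<open>a = 0\<close> if no slot survives. It counts the passed elements below \<open>z\<close>
  (all of them if there is no \<open>z\<close>), which are late candidates just like the blocked
  ones.\<close>

lemma blocked_excess:
  assumes S: "S \<subseteq> U" and inv: "run_inv S (U - S) st" and B: "B \<in> F" and v: "0 < v"
    and Z: "Z = {x \<in> opt U U. v \<le> w x}"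
    and Fl: "Fl = {j \<in> Z - S. j \<in> B \<and> j \<notin> snd st B \<and> \<not> open_slot w j (fst st B)}" "Fl \<noteq> {}"
  obtains j where "\<mu> B < j + card (Z \<inter> B)" "j \<le> \<mu> B" "card Fl + j \<le> card (late_cands U B (\<mu> B - j) S)"
proof -
  define X where "X = fst (fst st B)"
  define P where "P = snd st B"
  obtain y where y: "y \<in> Fl"
    using Fl(2) by blast
  have OU: "Z \<subseteq> U" "Z \<subseteq> opt U U"
    using opt_props(1)[of U U] by (auto simp: Z)
  have FlU: "Fl \<subseteq> Z \<inter> B" "Fl \<inter> S = {}" "Fl \<inter> P = {}"
    using Fl(1) by (auto simp: P_def)
  have loc: "local_inv S (U - S) B (fst st B) P"
    using run_invD(1)[OF inv B] by (simp add: P_def)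
  \<comment> \<open>A remaining dummy would be an open slot for the blocked
    \<open>y\<close>.\<close>
  have d0: "snd (fst st B) = 0"
    using y Fl(1) by (auto simp: open_slot_def)
  have XS: "X \<subseteq> opt S B" "X \<subseteq> S" "P \<subseteq> U - S"
    using local_invD(1,2)[OF loc] opt_props(1)[OF S, of B] by (auto simp: X_def)
  have total: "card X + card P = \<mu> B"
    using local_invD(4)[OF loc] by (simp add: X_def d0)
  have finP: "finite P" and finO: "finite Z" and finFl: "finite Fl"
    using XS OU finite_sub FlU(1) by (auto intro: finite_subset)
  have lateI: "card Q + card Fl \<le> card (late_cands U B a S)"
    if Q: "Q \<subseteq> P" and a: "\<And>x. x \<in> Q \<union> Fl \<Longrightarrow> a \<le> rk (up S x \<inter> B)" for Q a
  proof -
    have "x \<in> late_cands U B a S" if x: "x \<in> Fl" for x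
    proof -
      have "x \<in> opt U U" "0 < w x" "x \<in> B" "x \<in> U - S"
        using x FlU OU v by (auto simp: Z)
      then show ?thesis
        using cand_opt[OF _ _ S, of x B] a x by (simp add: late_cands_def)
    qed
    moreover have "x \<in> late_cands U B a S" if "x \<in> Q" for x
      using late_cands_passed[OF S inv B] that Q a by (auto simp: P_def)
    ultimately have "Q \<union> Fl \<subseteq> late_cands U B a S"
      by blast
    moreover have "finite (late_cands U B a S)"
      using finite_U by (simp add: late_cands_def)
    ultimately have "card (Q \<union> Fl) \<le> card (late_cands U B a S)"
      by (rule card_mono[rotated])
    moreover have "card (Q \<union> Fl) = card Q + card Fl"
      using Q FlU finP finFl by (intro card_Un_disjoint) (auto intro: finite_subset)
    ultimately show ?thesis
      by simp
  qed
  have "0 < card (Z \<inter> B)"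
    using y FlU(1) finO by (auto simp: card_gt_0_iff)
  show ?thesis
  proof (cases "X = {}")
    case True
    then have "card P + card Fl \<le> card (late_cands U B 0 S)" "card P = \<mu> B"
      using lateI[of P 0] total by auto
    then show ?thesis
      using that[of "\<mu> B"] \<open>0 < card (Z \<inter> B)\<close> by simp
  next
    case False
    have finX: "finite X"
      using XS(2) S finite_sub by auto
    obtain z where z: "z \<in> X" "\<And>x. x \<in> X \<Longrightarrow> w z \<le> w x"
      using arg_min_if_finite[OF finX False, of w] by (meson linorder_not_le)
    have below: "w x < w z" if "x \<in> Fl" for x
    proof -
      have "\<not> w z < w x"
        using that z(1) Fl(1) by (auto simp: open_slot_def X_def)
      moreover have "z \<in> U" "x \<in> U" "z \<noteq> x"
        using that z(1) XS(2) S FlU OU by blast+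
      then have "w z \<noteq> w x"
        using w_eq_iff by blast
      ultimately show ?thesis
        by simp
    qed
    have wz: "0 < w z"
      using below[OF y] y FlU(1) v by (auto simp: Z)
    define a where "a = rk ({x \<in> S. w z \<le> w x} \<inter> B)"
    have finOS: "finite (opt S B)"
      using opt_props(1)[OF S, of B] S finite_sub by auto
    have none: "{x \<in> X. w x < w z} = {}"
      using z(2) by force
    \<comment> \<open>No slot is left below the lightest survivor \<open>z\<close>, so the invariant
      equates the passed elements below \<open>z\<close> with all slots, dummies included, that were
      initially below it.\<close>
    have "card {x \<in> P. w x < w z} = card {x \<in> opt S B. w x < w z} + (\<mu> B - card (opt S B))"
      using local_invD(5)[OF loc, folded X_def, OF z(1)] by (simp add: d0 none)
    moreover have "card (opt S B) = card {x \<in> opt S B. w x < w z} + a"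
    proof -
      have "{x \<in> opt S B. w x < w z} \<union> {x \<in> opt S B. w z \<le> w x} = opt S B"
        by auto
      moreover have "card ({x \<in> opt S B. w x < w z} \<union> {x \<in> opt S B. w z \<le> w x}) =
          card {x \<in> opt S B. w x < w z} + card {x \<in> opt S B. w z \<le> w x}"
        using finOS by (intro card_Un_disjoint) auto
      ultimately have "card (opt S B) = card {x \<in> opt S B. w x < w z} + card {x \<in> opt S B. w z \<le> w x}"
        by simp
      then show ?thesis
        using opt_atleast_card[OF S wz] by (simp add: a_def)
    qed
    ultimately have j: "card {x \<in> P. w x < w z} = \<mu> B - a" and a_le: "a \<le> \<mu> B"
      using card_opt_le[OF S B] by auto
    have a_up: "a \<le> rk (up S x \<inter> B)" if "w x < w z" for x
      unfolding a_def using that S by (intro rk_mono) (auto simp: up_def)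
    \<comment> \<open>This gives the lower bound on \<open>j\<close>: the elements of
      \<open>B\<close> above \<open>y\<close> have smaller rank than the number of optimum elements
      in \<open>B\<close> down to \<open>y\<close>, and these all lie in \<open>Z\<close>.\<close>
    have "a \<le> rk (up U y \<inter> B)"
      unfolding a_def using below[OF y] S by (intro rk_mono) (auto simp: up_def)
    also have "\<dots> < card {x \<in> opt U U \<inter> B. w y \<le> w x}"
      using y FlU(1) v by (intro rk_above_opt B) (auto simp: Z)
    also have "\<dots> \<le> card (Z \<inter> B)"
      using y FlU(1) finO by (intro card_mono) (auto simp: Z)
    finally have "\<mu> B < (\<mu> B - a) + card (Z \<inter> B)"
      using a_le by linarith
    moreover have "card {x \<in> P. w x < w z} + card Fl \<le> card (late_cands U B a S)"
      using below a_up by (intro lateI) auto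
    ultimately show ?thesis
      using that[of "\<mu> B - a"] j a_le by simp
  qed
qed

end

section \<open>Aggregating the losses\<close>

context laminar_matroid
begin

text \<open>The indices that \<open>blocked_excess\<close> can produce at \<open>B\<close>, written
  additively to avoid truncated subtraction.\<close>

definition levels :: "'a set \<Rightarrow> 'a set \<Rightarrow> nat set" where
  "levels Z B = {j. \<mu> B < j + card (Z \<inter> B) \<and> j \<le> \<mu> B}"

lemma finite_levels: "finite (levels Z B)"
  by (rule finite_subset[of _ "{..\<mu> B}"]) (auto simp: levels_def)

text \<open>Sets with a common nonempty trace share a point, hence are nested, and equal capacities
  then exclude proper inclusion.\<close>

lemma inj_on_trace:
  assumes "G \<subseteq> F" "\<And>B. B \<in> G \<Longrightarrow> Z \<inter> B \<noteq> {}"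
    and "\<And>A B. \<lbrakk>A \<in> G; B \<in> G; Z \<inter> A = Z \<inter> B\<rbrakk> \<Longrightarrow> \<mu> A = \<mu> B"
  shows "inj_on (\<lambda>B. Z \<inter> B) G"
proof (rule inj_onI)
  fix A B assume AB: "A \<in> G" "B \<in> G" "Z \<inter> A = Z \<inter> B"
  then obtain x where "x \<in> A" "x \<in> B"
    using assms(2)[OF AB(1)] by blast
  then have "A \<subseteq> B \<or> B \<subseteq> A"
    using F_nested AB assms(1) by blast
  moreover have "\<not> A \<subset> B" "\<not> B \<subset> A"
    using mu_strict_mono[of A B] mu_strict_mono[of B A] AB assms(1) assms(3)[OF AB] by auto
  ultimately show "A = B"
    by blast
qed

text \<open>A singleton trace forces \<open>\<mu> B = j\<close>, which leaves at most
  \<open>card Z\<close> sets. Otherwise the slack \<open>m = \<mu> B - card (Z \<inter> B)\<close>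
  is below \<open>j\<close>. For fixed \<open>m\<close> equal traces mean equal capacities, so the
  traces are distinct; being laminar with at least two elements each, they number at most
  \<open>card Z\<close>. Altogether there are \<open>1 + j\<close> classes.\<close>

lemma card_levels_le:
  assumes Z: "Z \<subseteq> U" "ind Z"
  shows "card {B \<in> F. j \<in> levels Z B} \<le> Suc j * card Z"
proof -
  define G1 where "G1 = {B \<in> F. card (Z \<inter> B) = 1 \<and> \<mu> B = j}"
  define G where "G m = {B \<in> F. 2 \<le> card (Z \<inter> B) \<and> \<mu> B - card (Z \<inter> B) = m}" for m
  have finZ: "finite Z"
    using finite_sub[OF Z(1)] .
  have le: "card (Z \<inter> B) \<le> \<mu> B" if "B \<in> F" for B
    using ind_card_le[OF Z(2) that] .
  have "card G1 \<le> card Z"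
  proof -
    have "inj_on (\<lambda>B. Z \<inter> B) G1"
      by (rule inj_on_trace) (auto simp: G1_def)
    moreover have "(\<lambda>B. Z \<inter> B) ` G1 \<subseteq> (\<lambda>z. {z}) ` Z"
      by (auto simp: G1_def card_1_singleton_iff)
    ultimately have "card G1 \<le> card ((\<lambda>z. {z}) ` Z)"
      using finZ by (intro card_inj_on_le) auto
    also have "\<dots> \<le> card Z"
      by (rule card_image_le[OF finZ])
    finally show ?thesis .
  qed
  moreover have "card (G m) \<le> card Z" for m
  proof -
    have "inj_on (\<lambda>B. Z \<inter> B) (G m)"
    proof (rule inj_on_trace)
      fix A B assume "A \<in> G m" "B \<in> G m" "Z \<inter> A = Z \<inter> B"
      then show "\<mu> A = \<mu> B"
        using le[of A] le[of B] by (auto simp: G_def)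
    qed (auto simp: G_def)
    then have "card (G m) = card ((\<lambda>B. Z \<inter> B) ` G m)"
      by (simp add: card_image)
    also have "\<dots> \<le> card Z"
    proof (rule laminar_card_le[OF finZ])
      show "laminar ((\<lambda>B. Z \<inter> B) ` G m)"
        using laminar_F unfolding laminar_def G_def by blast
    qed (auto simp: G_def)
    finally show ?thesis .
  qed
  then have "card (\<Union>m<j. G m) \<le> j * card Z"
    using card_UN_le[of "{..<j}" G] sum_bounded_above[of "{..<j}" "\<lambda>m. card (G m)" "card Z"] by simp
  moreover have "{B \<in> F. j \<in> levels Z B} \<subseteq> G1 \<union> (\<Union>m<j. G m)"
  proof
    fix B assume "B \<in> {B \<in> F. j \<in> levels Z B}"
    then have B: "B \<in> F" "\<mu> B < j + card (Z \<inter> B)" "j \<le> \<mu> B"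
      by (auto simp: levels_def)
    show "B \<in> G1 \<union> (\<Union>m<j. G m)"
    proof (cases "card (Z \<inter> B) = 1")
      case True
      then show ?thesis
        using B by (simp add: G1_def)
    next
      case False
      then have "B \<in> G (\<mu> B - card (Z \<inter> B))" "\<mu> B - card (Z \<inter> B) < j"
        using B le[OF B(1)] by (auto simp: G_def)
      then show ?thesis
        by blast
    qed
  qed
  moreover have "finite (G1 \<union> (\<Union>m<j. G m))"
    using finite_F by (simp add: G1_def G_def)
  ultimately show ?thesis
    using card_mono[of "G1 \<union> (\<Union>m<j. G m)" "{B \<in> F. j \<in> levels Z B}"] card_Un_le[of G1 "\<Union>m<j. G m"]
    by simp
qed

lemma sum_levels_le:
  assumes Z: "Z \<subseteq> U" "ind Z"
  shows "(\<Sum>B\<in>F. \<Sum>j\<in>levels Z B. exp_excess j j) \<le> 27 / 1000 * real (card Z)"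
proof -
  \<comment> \<open>Exchanging the sums needs one finite range of \<open>j\<close> for all
    \<open>B\<close>. It starts at 1 because independence of \<open>Z\<close> gives
    \<open>card (Z \<inter> B) \<le> \<mu> B\<close>.\<close>
  have sub: "levels Z B \<subseteq> {1..\<mu> U}" if "B \<in> F" for B
  proof -
    have "\<mu> B \<le> \<mu> U"
      using mu_strict_mono[OF that U_in_F] F_subset[OF that] by (cases "B = U") (auto simp: psubset_eq)
    then show ?thesis
      using ind_card_le[OF Z(2) that] by (auto simp: levels_def)
  qed
  have "(\<Sum>B\<in>F. \<Sum>j\<in>levels Z B. exp_excess j j) = (\<Sum>B\<in>F. \<Sum>j\<in>{j \<in> {1..\<mu> U}. j \<in> levels Z B}. exp_excess j j)"
  proof (rule sum.cong[OF refl])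
    fix B assume "B \<in> F"
    then have "{j \<in> {1..\<mu> U}. j \<in> levels Z B} = levels Z B"
      using sub by blast
    then show "(\<Sum>j\<in>levels Z B. exp_excess j j) = (\<Sum>j\<in>{j \<in> {1..\<mu> U}. j \<in> levels Z B}. exp_excess j j)"
      by simp
  qed
  also have "\<dots> = (\<Sum>j = 1..\<mu> U. \<Sum>B\<in>{B \<in> F. j \<in> levels Z B}. exp_excess j j)"
    using finite_F by (intro sum.swap_restrict) auto
  also have "\<dots> = (\<Sum>j = 1..\<mu> U. real (card {B \<in> F. j \<in> levels Z B}) * exp_excess j j)"
    by simp
  also have "\<dots> \<le> (\<Sum>j = 1..\<mu> U. real (Suc j * card Z) * exp_excess j j)"
    using card_levels_le[OF Z] by (intro sum_mono mult_right_mono exp_excess_nonneg of_nat_mono)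
  also have "\<dots> = (\<Sum>j = 1..\<mu> U. real (Suc j) * exp_excess j j) * real (card Z)"
    unfolding of_nat_mult sum_distrib_right by (simp only: mult_ac)
  also have "\<dots> \<le> 27 / 1000 * real (card Z)"
    using sum_exp_excess_diag by (intro mult_right_mono) auto
  finally show ?thesis .
qed

text \<open>Every lost element of \<open>Z\<close> is blocked at some \<open>B\<close>. The index
  from \<open>blocked_excess\<close> depends on the run, so it is replaced by the sum over all
  levels, which depends on the sample only.\<close>

lemma lost_card_le:
  assumes \<pi>: "\<pi> \<in> permutations_of_set U" and v: "0 < v" and Z: "Z = {x \<in> opt U U. v \<le> w x}"
    and S: "S = set (take t \<pi>)"
  shows "card (Z - S) \<le> card (Z \<inter> kicknext F \<mu> w U \<pi> t) +
    (\<Sum>B\<in>F. \<Sum>j\<in>levels Z B. card (late_cands U B (\<mu> B - j) S) - j)"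
proof -
  obtain st where st: "kicknext F \<mu> w U \<pi> t = snd st U" and inv: "run_inv S (U - S) st"
    using run_inv_kicknext[OF \<pi>] S by blast
  have SU: "S \<subseteq> U"
    using \<pi> S by (auto simp: permutations_of_set_def dest: in_set_takeD)
  have ZU: "Z \<subseteq> U"
    using opt_props(1)[of U U] by (auto simp: Z)
  define Fl where "Fl B = {j \<in> Z - S. j \<in> B \<and> j \<notin> snd st B \<and> \<not> open_slot w j (fst st B)}" for B
  have finFl: "finite (Fl B)" for B
    using finite_sub[OF ZU] by (simp add: Fl_def)
  have Fl: "card (Fl B) \<le> (\<Sum>j\<in>levels Z B. card (late_cands U B (\<mu> B - j) S) - j)" if B: "B \<in> F" for B
  proof (cases "Fl B = {}")
    case False
    obtain j where "\<mu> B < j + card (Z \<inter> B)" "j \<le> \<mu> B"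
      and le: "card (Fl B) + j \<le> card (late_cands U B (\<mu> B - j) S)"
      using blocked_excess[OF SU inv B v Z Fl_def False] by blast
    then have "j \<in> levels Z B"
      by (simp add: levels_def)
    then have "card (late_cands U B (\<mu> B - j) S) - j \<le> (\<Sum>j\<in>levels Z B. card (late_cands U B (\<mu> B - j) S) - j)"
      by (intro member_le_sum finite_levels) auto
    then show ?thesis
      using le by linarith
  qed simp
  have "Z - S \<subseteq> (Z \<inter> snd st U) \<union> (\<Union>B\<in>F. Fl B)"
    using run_invD(3)[OF inv] ZU by (auto simp: Fl_def)
  then have "card (Z - S) \<le> card ((Z \<inter> snd st U) \<union> (\<Union>B\<in>F. Fl B))"
    using finite_sub[OF ZU] finite_F finFl by (intro card_mono) auto
  also have "\<dots> \<le> card (Z \<inter> snd st U) + card (\<Union>B\<in>F. Fl B)"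
    by (rule card_Un_le)
  also have "card (\<Union>B\<in>F. Fl B) \<le> (\<Sum>B\<in>F. card (Fl B))"
    by (rule card_UN_le[OF finite_F])
  also have "\<dots> \<le> (\<Sum>B\<in>F. \<Sum>j\<in>levels Z B. card (late_cands U B (\<mu> B - j) S) - j)"
    by (rule sum_mono[OF Fl])
  finally show ?thesis
    by (simp add: st)
qed

section \<open>Taking expectations\<close>

abbreviation model :: "('a list \<times> nat) pmf" where
  "model \<equiv> pair_pmf (pmf_of_set (permutations_of_set U)) (binomial_pmf (card U) (1 - 2 / 25))"

lemma set_pmf_model: "set_pmf model = permutations_of_set U \<times> {..card U}"
  using finite_U set_pmf_binomial_eq[of "1 - 2 / 25" "card U"] by simp

lemma integrable_model: "integrable (measure_pmf model) (f :: _ \<Rightarrow> real)"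
  by (rule integrable_measure_pmf_finite) (simp only: set_pmf_model finite_SigmaI finite_atMost finite_permutations_of_set)

lemma expectation_model_mono:
  fixes f g :: "'a list \<times> nat \<Rightarrow> real"
  assumes "\<And>\<pi> t. \<pi> \<in> permutations_of_set U \<Longrightarrow> f (\<pi>, t) \<le> g (\<pi>, t)"
  shows "measure_pmf.expectation model f \<le> measure_pmf.expectation model g"
proof (rule integral_mono_AE[OF integrable_model integrable_model])
  show "AE x in measure_pmf model. f x \<le> g x"
    unfolding AE_measure_pmf_iff set_pmf_model using assms by auto
qed

text \<open>The share of \<open>Z\<close> outside the sample minus the bound on the losses:
  \<open>2/25 - 27/1000 = 53/1000\<close>.\<close>

lemma expected_top_card_ge:
  assumes v: "0 < v" and Z: "Z = {x \<in> opt U U. v \<le> w x}"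
  shows "53 / 1000 * real (card Z) \<le>
    measure_pmf.expectation model (\<lambda>(\<pi>, t). real (card (Z \<inter> kicknext F \<mu> w U \<pi> t)))"
proof -
  have OU: "opt U U \<subseteq> U"
    using opt_props(1)[of U U] by auto
  have ZU: "Z \<subseteq> U"
    using OU by (auto simp: Z)
  have indZ: "ind Z"
    using ind_subset[OF opt_props(2)[of U U] _ OU] by (auto simp: Z)
  let ?ex = "\<lambda>S B j. real (card (late_cands U B (\<mu> B - j) S) - j)"
  let ?g = "\<lambda>S. real (card (Z - S)) - (\<Sum>B\<in>F. \<Sum>j\<in>levels Z B. ?ex S B j)"
  have "bern_sum (2 / 25) U ?g = 2 / 25 * real (card Z) -
      (\<Sum>B\<in>F. \<Sum>j\<in>levels Z B. bern_sum (2 / 25) U (\<lambda>S. ?ex S B j))"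
    using finite_U ZU by (simp only: bern_sum_diff bern_sum_sum bern_sum_card_diff)
  moreover have "(\<Sum>B\<in>F. \<Sum>j\<in>levels Z B. bern_sum (2 / 25) U (\<lambda>S. ?ex S B j)) \<le>
      (\<Sum>B\<in>F. \<Sum>j\<in>levels Z B. exp_excess j j)"
  proof (intro sum_mono)
    fix B j assume "B \<in> F" "j \<in> levels Z B"
    \<comment> \<open>With \<open>a = \<mu> B - j\<close> exactly \<open>j\<close> successes are
      still to come, since \<open>j \<le> \<mu> B\<close>; this lands on the diagonal of
      \<open>exp_excess\<close>.\<close>
    then show "bern_sum (2 / 25) U (\<lambda>S. ?ex S B j) \<le> exp_excess j j"
      using bern_sum_excess[of B "\<mu> B - j" j] by (simp add: levels_def)
  qed
  ultimately have "53 / 1000 * real (card Z) \<le> bern_sum (2 / 25) U ?g"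
    using sum_levels_le[OF ZU indZ] by linarith
  also have "\<dots> = measure_pmf.expectation model (\<lambda>(\<pi>, t). ?g (set (take t \<pi>)))"
    by (rule expectation_sample_eq_bern_sum[symmetric]) (use finite_U in auto)
  also have "\<dots> \<le> measure_pmf.expectation model (\<lambda>(\<pi>, t). real (card (Z \<inter> kicknext F \<mu> w U \<pi> t)))"
  proof (rule expectation_model_mono)
    fix \<pi> t assume "\<pi> \<in> permutations_of_set U"
    from of_nat_mono[OF lost_card_le[OF this v Z refl, of t], where 'a = real]
    show "(case (\<pi>, t) of (\<pi>, t) \<Rightarrow> ?g (set (take t \<pi>))) \<le>
        (case (\<pi>, t) of (\<pi>, t) \<Rightarrow> real (card (Z \<inter> kicknext F \<mu> w U \<pi> t)))"
      by simp
  qed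
  finally show ?thesis .
qed

lemma kicknext_subset:
  assumes "\<pi> \<in> permutations_of_set U"
  shows "kicknext F \<mu> w U \<pi> t \<subseteq> U"
proof -
  obtain st where st: "kicknext F \<mu> w U \<pi> t = snd st U"
    and inv: "run_inv (set (take t \<pi>)) (U - set (take t \<pi>)) st"
    using run_inv_kicknext[OF assms] by blast
  show ?thesis
    using local_invD(1)[OF run_invD(1)[OF inv U_in_F]] by (auto simp: st)
qed

lemma kicknext_competitive: "53 / 1000 * sum w (opt U U) \<le> kicknext_expected (2 / 25) F \<mu> w U"
proof -
  let ?K = "\<lambda>(\<pi>, t). kicknext F \<mu> w U \<pi> t"
  let ?E = "measure_pmf.expectation model"
  \<comment> \<open>\<open>g x\<close> is the probability that \<open>x\<close> is output. Abel
    summation turns the bounds for all upper weight classes into a weighted bound; output elements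
    outside the optimum only add weight.\<close>
  define g where "g x = ?E (\<lambda>a. indicator (?K a) x :: real)" for x
  have OU: "opt U U \<subseteq> U"
    using opt_props(1)[of U U] by auto
  have finO: "finite (opt U U)"
    using finite_sub[OF OU] .
  have "0 \<le> (\<Sum>x\<in>opt U U. w x * (g x - 53 / 1000))"
  proof (rule abel_nonneg[OF finO])
    show "0 \<le> w x" if "x \<in> opt U U" for x
      using w_nonneg OU that by blast
    fix v :: real assume v: "0 < v"
    let ?Z = "{x \<in> opt U U. v \<le> w x}"
    have "(\<Sum>x\<in>?Z. g x) = ?E (\<lambda>a. \<Sum>x\<in>?Z. indicator (?K a) x)"
      unfolding g_def by (rule Bochner_Integration.integral_sum[symmetric]) (rule integrable_model)
    also have "\<dots> = ?E (\<lambda>(\<pi>, t). real (card (?Z \<inter> kicknext F \<mu> w U \<pi> t)))"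
      using finO by (intro Bochner_Integration.integral_cong) (auto simp: indicator_def sum.If_cases Int_def)
    finally show "0 \<le> (\<Sum>x\<in>?Z. g x - 53 / 1000)"
      using expected_top_card_ge[OF v refl] by (simp add: sum_subtractf)
  qed
  also have "\<dots> = (\<Sum>x\<in>opt U U. w x * g x) - sum w (opt U U) * (53 / 1000)"
    by (simp only: right_diff_distrib sum_subtractf sum_distrib_right)
  finally have "53 / 1000 * sum w (opt U U) \<le> (\<Sum>x\<in>opt U U. w x * g x)"
    by simp
  also have "\<dots> = ?E (\<lambda>a. \<Sum>x\<in>opt U U. w x * indicator (?K a) x)"
    unfolding g_def
    by (subst Bochner_Integration.integral_sum, rule integrable_model) (simp only: integral_mult_right_zero)
  also have "\<dots> \<le> ?E (\<lambda>(\<pi>, t). sum w (kicknext F \<mu> w U \<pi> t))"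
  proof (rule expectation_model_mono)
    fix \<pi> t assume \<pi>: "\<pi> \<in> permutations_of_set U"
    let ?k = "kicknext F \<mu> w U \<pi> t"
    have k: "?k \<subseteq> U" "finite ?k"
      using kicknext_subset[OF \<pi>] finite_sub by auto
    have "(\<Sum>x\<in>opt U U. w x * indicator ?k x) = sum w (opt U U \<inter> ?k)"
      unfolding sum.inter_restrict[OF finO] by (intro sum.cong) auto
    also have "\<dots> \<le> sum w ?k"
      using k w_nonneg by (intro sum_mono2) auto
    finally show "(\<Sum>x\<in>opt U U. w x * indicator (?K (\<pi>, t)) x) \<le> (case (\<pi>, t) of (\<pi>, t) \<Rightarrow> sum w (kicknext F \<mu> w U \<pi> t))"
      by simp
  qed
  finally show ?thesis
    by (simp add: kicknext_expected_def)
qed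

end

theorem theorem2:
  fixes U :: "'a set" and F :: "'a set set" and \<mu> :: "'a set \<Rightarrow> nat" and w :: "'a \<Rightarrow> real"
  assumes "finite U"
    and "\<forall>x\<in>U. w x \<ge> 0"
    and "inj_on w U"
    and "F \<subseteq> Pow U" and "U \<in> F" and "laminar F"
    and "\<forall>A\<in>F. \<mu> A > 0"
    and "\<forall>A\<in>F. \<forall>B\<in>F. A \<subset> B \<longrightarrow> \<mu> A < \<mu> B"
  shows "kicknext_expected 0.08 F \<mu> w U \<ge> 0.053 * sum w (OPT F \<mu> w U U)"
proof -
  interpret laminar_matroid U F \<mu> w
    using assms by unfold_locales auto
  show ?thesis
    using kicknext_competitive by simp
qed

end
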